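(* Let $(E,\|\cdot\|)$ be a (real) Banach space with a shrinking basis $(e_n)_{n=1}^\infty$. The following are equivalent. (a) $E$ is isomorphically polyhedral. (b) There exists a norm $|||\cdot|||$ on $E$, equivalent to $\|\cdot\|$, such that $(e_n)$ is a monotone basis with respect to $|||\cdot|||$, and for every $\sum_{n=1}^\infty a_ne_n\in E$ there exists $m\in\mathbb{N}$ such that $$\Big|\Big|\Big|\sum_{n=1}^\infty a_ne_n\Big|\Big|\Big|=\Big|\Big|\Big|\sum_{n=1}^m a_ne_n\Big|\Big|\Big|.$$
   Context: All Banach spaces are real. A Banach space is polyhedral if the closed unit ball of each of its finite dimensional subspaces is a polyhedron (i.e., the convex hull of finitely many points). A Banach space is isomorphically polyhedral if it is (linearly) isomorphic to a polyhedral Banach space. "Basis" means Schauder basis. A basis $(e_n)$ of $E$ with associated partial sum projections $P_n$ is shrinking if $P_n'x'\to x'$ in norm for every $x'\in E'$ (equivalently, the biorthogonal functionals form a basis of the dual $E'$). If $(e_n)$ is a basis of $E$ and $|||\cdot|||$ is an equivalent norm on $E$, then $(e_n)$ is monotone with respect to $|||\cdot|||$ if $|||\sum_{n=1}^k a_ne_n|||\le |||\sum_{n=1}^{k+1}a_ne_n|||$ for every real sequence $(a_n)$ and all $k\in\mathbb{N}$. *)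

theory Defs
  imports "HOL-Analysis.Analysis"
begin

text \<open>
  Several norms on one vector space have to be considered, so a normed space is given as a type
  of class \<open>real_vector\<close> together with a function \<open>N\<close> that is a norm on it.
\<close>

definition is_norm :: "('a::real_vector \<Rightarrow> real) \<Rightarrow> bool" where
  "is_norm N \<longleftrightarrow>
     (\<forall>x. N x = 0 \<longleftrightarrow> x = 0) \<and>
     (\<forall>x y. N (x + y) \<le> N x + N y) \<and>
     (\<forall>c x. N (c *\<^sub>R x) = \<bar>c\<bar> * N x)"

definition is_banach_norm :: "('a::real_vector \<Rightarrow> real) \<Rightarrow> bool" where
  "is_banach_norm N \<longleftrightarrow> is_norm N \<and> Metric_space.mcomplete UNIV (\<lambda>x y. N (x - y))"

definition equivalent_norms :: "('a::real_vector \<Rightarrow> real) \<Rightarrow> ('a \<Rightarrow> real) \<Rightarrow> bool" where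
  "equivalent_norms M N \<longleftrightarrow>
     (\<exists>c>0. \<exists>C>0. \<forall>x. c * M x \<le> N x \<and> N x \<le> C * M x)"

definition isomorphic_normed ::
  "('a::real_vector \<Rightarrow> real) \<Rightarrow> ('b::real_vector \<Rightarrow> real) \<Rightarrow> bool" where
  "isomorphic_normed M N \<longleftrightarrow>
     (\<exists>T. linear T \<and> bij T \<and>
        (\<exists>c>0. \<exists>C>0. \<forall>x. c * M x \<le> N (T x) \<and> N (T x) \<le> C * M x))"

text \<open>The finite-dimensional subspaces are exactly the spans of finite sets.\<close>

definition polyhedral_norm :: "('a::real_vector \<Rightarrow> real) \<Rightarrow> bool" where
  "polyhedral_norm N \<longleftrightarrow> (\<forall>B. finite B \<longrightarrow> polytope {x \<in> span B. N x \<le> 1})"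

text \<open>
  HOL cannot quantify over types inside a formula, so the polyhedral Banach space is taken on the
  same real vector space, with an arbitrary complete norm. This loses no generality: by
  \<open>isomorphically_polyhedralI\<close> below, an isomorphic polyhedral Banach space on any other
  type can be replaced by one of this form.
\<close>

definition isomorphically_polyhedral :: "('a::real_vector \<Rightarrow> real) \<Rightarrow> bool" where
  "isomorphically_polyhedral M \<longleftrightarrow>
     (\<exists>N :: 'a \<Rightarrow> real. is_banach_norm N \<and> polyhedral_norm N \<and> isomorphic_normed M N)"

lemma is_norm_Metric_space:
  assumes "is_norm N"
  shows "Metric_space UNIV (\<lambda>x y. N (x - y))"
proof
  have tri: "N (x + y) \<le> N x + N y" and sc: "N (c *\<^sub>R x) = \<bar>c\<bar> * N x"
    and z: "N x = 0 \<longleftrightarrow> x = 0" for x y c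
    using assms by (auto simp: is_norm_def)
  have neg: "N (- x) = N x" for x
    using sc[of "-1" x] by simp
  show "0 \<le> N (x - y)" for x y
    using tri[of "x - y" "- (x - y)"] neg[of "x - y"] z[of 0] by simp
  show "N (x - y) = N (y - x)" for x y
    using neg[of "x - y"] by simp
  show "N (x - y) = 0 \<longleftrightarrow> x = y" for x y
    by (simp add: z)
  show "N (x - w) \<le> N (x - y) + N (y - w)" for x y w
    using tri[of "x - y" "y - w"] by simp
qed

lemma isomorphically_polyhedralI:
  fixes M :: "'a::real_vector \<Rightarrow> real" and N :: "'b::real_vector \<Rightarrow> real"
  assumes banach: "is_banach_norm N" and poly: "polyhedral_norm N"
    and iso: "isomorphic_normed M N"
  shows "isomorphically_polyhedral M"
proof -
  obtain T c C where T: "linear T" "bij T" and cC: "c > 0" "C > 0"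
    and bd: "\<And>x. c * M x \<le> N (T x) \<and> N (T x) \<le> C * M x"
    using iso unfolding isomorphic_normed_def by blast
  define S where "S = inv T"
  have TS: "T (S y) = y" and ST: "S (T x) = x" for x y
    using T(2) by (auto simp: S_def bij_is_surj surj_f_inv_f bij_is_inj)
  have S: "linear S"
  proof (rule linearI)
    show "S (x + y) = S x + S y" for x y
      using ST[of "S x + S y"] by (simp add: linear_add[OF T(1)] TS)
    show "S (r *\<^sub>R x) = r *\<^sub>R S x" for r x
      using ST[of "r *\<^sub>R S x"] by (simp add: linear_cmul[OF T(1)] TS)
  qed
  define N' where "N' = N \<circ> T"
  have norm: "is_norm N" and compl: "Metric_space.mcomplete UNIV (\<lambda>x y. N (x - y))"
    using banach by (auto simp: is_banach_norm_def)
  have T0: "T x = 0 \<longleftrightarrow> x = 0" for x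
    using ST[of x] ST[of 0] linear_0[OF T(1)] by auto
  have norm': "is_norm N'"
    using norm by (auto simp: is_norm_def N'_def T0 linear_add[OF T(1)] linear_cmul[OF T(1)])
  interpret N: Metric_space UNIV "\<lambda>x y. N (x - y)"
    by (rule is_norm_Metric_space[OF norm])
  interpret N': Metric_space UNIV "\<lambda>x y. N' (x - y)"
    by (rule is_norm_Metric_space[OF norm'])
  have dist: "N' (x - y) = N (T x - T y)" for x y
    by (simp add: N'_def linear_diff[OF T(1)])
  have "N'.mcomplete"
    unfolding N'.mcomplete_def
  proof (intro allI impI)
    fix s assume s: "N'.MCauchy s"
    have "N.MCauchy (T \<circ> s)"
      using s unfolding N.MCauchy_def N'.MCauchy_def by (simp add: dist)
    then obtain y where "limitin N.mtopology (T \<circ> s) y sequentially"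
      using compl unfolding N.mcomplete_def by blast
    then have "limitin N'.mtopology s (S y) sequentially"
      unfolding N.limitin_metric N'.limitin_metric by (simp add: dist TS)
    then show "\<exists>x. limitin N'.mtopology s x sequentially" by blast
  qed
  then have 1: "is_banach_norm N'"
    using norm' by (simp add: is_banach_norm_def)
  have 2: "polyhedral_norm N'"
    unfolding polyhedral_norm_def
  proof (intro allI impI)
    fix B :: "'a set" assume B: "finite B"
    have eq: "{x \<in> span B. N' x \<le> 1} = S ` {y \<in> span (T ` B). N y \<le> 1}"
    proof -
      have "span (T ` B) = T ` span B"
        by (rule linear_span_image[OF T(1)])
      then have "S ` {y \<in> span (T ` B). N y \<le> 1} = S ` T ` {x \<in> span B. N (T x) \<le> 1}"
        by auto
      then show ?thesis
        by (simp add: image_image ST N'_def)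
    qed
    have "polytope {y \<in> span (T ` B). N y \<le> 1}"
      using poly B by (simp add: polyhedral_norm_def)
    then show "polytope {x \<in> span B. N' x \<le> 1}"
      unfolding eq by (rule polytope_linear_image[OF S])
  qed
  have 3: "isomorphic_normed M N'"
    unfolding isomorphic_normed_def
    by (rule exI[of _ id]) (use bd cC in \<open>auto simp: N'_def linear_id\<close>)
  show ?thesis
    using 1 2 3 unfolding isomorphically_polyhedral_def by blast
qed

definition schauder_basis :: "(nat \<Rightarrow> 'a::real_normed_vector) \<Rightarrow> bool" where
  "schauder_basis e \<longleftrightarrow> (\<forall>x. \<exists>!a :: nat \<Rightarrow> real. (\<lambda>n. a n *\<^sub>R e n) sums x)"

definition basis_coeff :: "(nat \<Rightarrow> 'a::real_normed_vector) \<Rightarrow> 'a \<Rightarrow> nat \<Rightarrow> real" where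
  "basis_coeff e x = (THE a. (\<lambda>n. a n *\<^sub>R e n) sums x)"

text \<open>Bases are indexed from 0, so the following projection has rank \<open>k + 1\<close>.\<close>

definition basis_proj :: "(nat \<Rightarrow> 'a::real_normed_vector) \<Rightarrow> nat \<Rightarrow> 'a \<Rightarrow> 'a" where
  "basis_proj e k x = (\<Sum>n\<le>k. basis_coeff e x n *\<^sub>R e n)"

text \<open>
  The limit is in the norm of the dual. The partial sum projections of a Schauder basis of a Banach
  space are bounded, so \<^term>\<open>Blinfun\<close> applied to them is the projection itself.
\<close>

definition shrinking :: "(nat \<Rightarrow> 'a::banach) \<Rightarrow> bool" where
  "shrinking e \<longleftrightarrow>
     (\<forall>f :: 'a \<Rightarrow>\<^sub>L real. (\<lambda>k. f o\<^sub>L Blinfun (basis_proj e k)) \<longlonglongrightarrow> f)"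

definition monotone_basis_wrt ::
  "('a::real_vector \<Rightarrow> real) \<Rightarrow> (nat \<Rightarrow> 'a) \<Rightarrow> bool" where
  "monotone_basis_wrt N e \<longleftrightarrow>
     (\<forall>a :: nat \<Rightarrow> real. \<forall>k. N (\<Sum>n\<le>k. a n *\<^sub>R e n) \<le> N (\<Sum>n\<le>Suc k. a n *\<^sub>R e n))"

end

(*
  (b) implies (a): the partial sum projections P_m have finite rank, so finitely many functionals
  g <= N o P_m norm their range up to a factor 1 - 1/(m+3). Multiplied by weights w_m that
  decrease to 1, they define an equivalent norm M which exceeds N at every nonzero point, because
  N x = N (P_m x) for large m. Near a given point only finitely many of the functionals can
  therefore be active, and by compactness the unit ball of M in a finite-dimensional subspace is
  cut out by finitely many half-spaces.

  (a) implies (b): a polyhedral norm is linear on a short segment starting at any point in any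
  direction. By Baire it is Gateaux differentiable on a dense set; at such a point the cone on which
  N agrees with its derivative has interior, so there are only countably many derivatives f_n, and
  every N x equals some f_n x. As the basis is shrinking, f_n o P_k is within delta_n of f_n for
  some k = kappa_n. The norm M x = sup {w_n |f_n (P_k x)| : k <= kappa_n} is monotone by construction,
  and it is attained because it exceeds N x and all N (P_k x), while the terms with large n do
  not exceed sup_k N (P_k x) by much.
*)
theory Submission
  imports Defs
begin

text \<open>From (b) to (a) a strict excess is wanted because it survives with a factor: if
  \<open>|h x| > N x\<close> at a nonzero \<open>x\<close>, then \<open>|h| > a N\<close> near
  \<open>x\<close> for some \<open>a > 1\<close>, while every functional of weight below
  \<open>a\<close> stays below \<open>a N\<close>. The factor \<open>1 - 1/(m+3)\<close> is the
  price of norming a sphere by finitely many functionals; the weights must repay it and still tend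
  to 1. From (a) to (b) the given norm need not be monotone. Allowing all f_n o P_k would repair
  this, but a supremum over infinitely many k need not be attained. The cut at kappa_n leaves only
  finitely many functionals with weight above any given number greater than 1. The functional f_n
  itself is lost, and the same weights repay the error delta_n. Polyhedrality enters through planes.
  It makes the one-sided derivative an exact slope on a segment, so that \<open>N\<close> equals its
  derivative on a closed cone instead of being merely tangent to it. This exactness is what Baire's
  theorem turns into interior points and hence into countability.\<close>

section \<open>Norms as functions, Baire category, compactness\<close>

lemma is_normD:
  assumes "is_norm N"
  shows is_norm_zero: "N 0 = 0" and is_norm_eq_0_iff: "N x = 0 \<longleftrightarrow> x = 0"
    and is_norm_triangle: "N (x + y) \<le> N x + N y"
    and is_norm_scale: "N (c *\<^sub>R x) = \<bar>c\<bar> * N x"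
    and is_norm_minus: "N (- x) = N x"
    and is_norm_nonneg: "0 \<le> N x"
    and is_norm_diff_le: "N x - N y \<le> N (x - y)"
proof -
  have tri: "N (x + y) \<le> N x + N y" and sc: "N (c *\<^sub>R x) = \<bar>c\<bar> * N x"
    and z: "N x = 0 \<longleftrightarrow> x = 0" for x y c
    using assms by (auto simp: is_norm_def)
  have neg: "N (- x) = N x" for x
    using sc[of "-1" x] by simp
  show "N 0 = 0" "N x = 0 \<longleftrightarrow> x = 0" "N (x + y) \<le> N x + N y" "N (c *\<^sub>R x) = \<bar>c\<bar> * N x" "N (- x) = N x"
    by (fact z[of 0, simplified] z tri sc neg)+
  show "0 \<le> N x" using tri[of x "-x"] neg[of x] z[of 0] by simp
  show "N x - N y \<le> N (x - y)" using tri[of "x - y" y] by simp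
qed

lemma is_norm_pos: "is_norm N \<Longrightarrow> x \<noteq> 0 \<Longrightarrow> 0 < N x"
  using is_norm_nonneg is_norm_eq_0_iff by (metis order_le_less)

lemma equivalent_norms_normE:
  fixes N :: "'a::real_normed_vector \<Rightarrow> real"
  assumes "equivalent_norms norm N"
  obtains c C where "c > 0" "C > 0" "\<And>x. c * norm x \<le> N x" "\<And>x. N x \<le> C * norm x"
  using assms unfolding equivalent_norms_def by blast

text \<open>The one-sided bound suffices since \<open>x\<close> and \<open>y\<close> may be
  exchanged. It is the form that subadditivity delivers.\<close>

lemma lipschitz_continuous_on:
  fixes p :: "'a::real_normed_vector \<Rightarrow> real"
  assumes "\<And>x y. p x - p y \<le> C * norm (x - y)"
  shows "continuous_on S p"
proof (rule continuous_on_subset[OF _ subset_UNIV], rule lipschitz_on_continuous_on[of "\<bar>C\<bar>"])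
  have 1: "p x - p y \<le> \<bar>C\<bar> * norm (x - y)" for x y
    by (rule order_trans[OF assms]) (simp add: mult_right_mono)
  show "\<bar>C\<bar>-lipschitz_on UNIV p"
  proof (rule lipschitz_onI)
    show "dist (p x) (p y) \<le> \<bar>C\<bar> * dist x y" for x y
      using 1[of x y] 1[of y x] by (auto simp: dist_norm norm_minus_commute abs_le_iff)
  qed simp
qed

lemma equivalent_norm_continuous_on:
  fixes N :: "'a::real_normed_vector \<Rightarrow> real"
  assumes "is_norm N" "equivalent_norms norm N"
  shows "continuous_on S N"
proof -
  obtain c C where "\<And>x. N x \<le> C * norm x"
    using equivalent_norms_normE[OF assms(2)] by metis
  then show ?thesis
    using is_norm_diff_le[OF assms(1)] by (intro lipschitz_continuous_on[of _ C]) (meson order_trans)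
qed

lemma linear_bounded_continuous_on:
  fixes h :: "'a::real_normed_vector \<Rightarrow> real"
  assumes "linear h" "\<And>x. \<bar>h x\<bar> \<le> C * norm x"
  shows "continuous_on S h"
  using assms(2)[of "_ - _"] by (intro lipschitz_continuous_on[of _ C]) (simp add: linear_diff[OF assms(1)] abs_le_iff)

lemma Baire_open_dense:
  fixes U :: "nat \<Rightarrow> 'a::complete_space set"
  assumes "\<And>n. open (U n)" "\<And>n. closure (U n) = UNIV"
  shows "closure (\<Inter>n. U n) = UNIV"
proof -
  have "Met_TC.mtopology closure_of \<Inter> (range U) = UNIV"
    by (rule Met_TC.metric_Baire_category) (use assms in \<open>auto simp: complete_UNIV\<close>)
  then show ?thesis by simp
qed

lemma Baire_closed_union:
  fixes S :: "nat \<Rightarrow> 'a::complete_space set"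
  assumes "\<And>n. closed (S n)" "(\<Union>n. S n) = UNIV"
  obtains n where "interior (S n) \<noteq> {}"
proof (rule ccontr)
  assume "\<not> thesis"
  then have "interior (S n) = {}" for n using that by blast
  then have "closure (\<Inter>n. - S n) = UNIV"
    using assms by (intro Baire_open_dense) (auto simp: closure_complement)
  then show False using assms(2) by (auto simp flip: Compl_UN)
qed

text \<open>Induction on \<open>B\<close>. Compactness of the bounded parts makes
  \<open>span B\<close> closed, so a vector \<open>b\<close> outside it has a positive distance
  \<open>d\<close> from it. This bounds the coefficient of \<open>b\<close> by
  \<open>|r| / d\<close>, and the set becomes a closed part of the image of a compact
  product.\<close>

lemma compact_span_cball:
  fixes B :: "'a::real_normed_vector set"
  assumes "finite B"
  shows "compact (span B \<inter> cball 0 r)"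
  using assms
proof (induction B arbitrary: r rule: finite_induct)
  case empty
  then show ?case by (simp add: finite_imp_compact)
next
  case (insert b B)
  show ?case
  proof (cases "b \<in> span B")
    case True
    then show ?thesis using insert.IH by (simp add: span_redundant)
  next
    case False
    have cl: "closed (span B)"
    proof (subst closed_sequential_limits, intro allI impI)
      fix x l assume "(\<forall>n. x n \<in> span B) \<and> x \<longlonglongrightarrow> l"
      then have x: "\<And>n. x n \<in> span B" "x \<longlonglongrightarrow> l" by auto
      obtain R where R: "\<And>n. norm (x n) \<le> R"
        using convergent_imp_Bseq[OF convergentI[OF x(2)]] by (auto simp: Bseq_def)
      show "l \<in> span B"
        using closed_sequentially[OF compact_imp_closed[OF insert.IH[of R]], of x l] x R
        by auto
    qed
    then obtain d where d: "d > 0" "ball b d \<subseteq> - span B"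
      using False openE[of "- span B" b] by auto
    have d': "d \<le> norm (b - y)" if "y \<in> span B" for y
      using d(2) that by (force simp: dist_norm)
    define R where "R = \<bar>r\<bar> / d"
    define K where "K = (\<lambda>(t, y). t *\<^sub>R b + y) ` ({-R..R} \<times> (span B \<inter> cball 0 (\<bar>r\<bar> + R * norm b)))"
    have "compact K"
      unfolding K_def
      by (intro compact_continuous_image compact_Times insert.IH compact_Icc)
        (auto simp: case_prod_beta intro!: continuous_intros)
    moreover have "span (insert b B) \<inter> cball 0 r = K \<inter> cball 0 r"
    proof -
      have "K \<subseteq> span (insert b B)"
        by (auto simp: K_def intro!: span_add span_scale intro: span_base span_mono[THEN subsetD, of B])
      moreover have "x \<in> K" if x: "x \<in> span (insert b B)" "norm x \<le> r" for x
      proof -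
        obtain t where t: "x - t *\<^sub>R b \<in> span B" using x(1) by (auto simp: span_breakdown_eq)
        \<comment> \<open>\<open>x / t\<close> is the difference of \<open>b\<close> and a point of
          \<open>span B\<close>, so its norm is at least \<open>d\<close>.\<close>
        have "\<bar>t\<bar> * d \<le> \<bar>r\<bar>"
        proof (cases "t = 0")
          case False
          have "d \<le> norm (b - (- (1/t)) *\<^sub>R (x - t *\<^sub>R b))"
            by (intro d' span_scale t)
          also have "b - (- (1/t)) *\<^sub>R (x - t *\<^sub>R b) = (1/t) *\<^sub>R x"
            using False by (simp add: algebra_simps)
          finally show ?thesis using False x(2) by (simp add: field_simps)
        qed simp
        then have tR: "\<bar>t\<bar> \<le> R" using d(1) by (simp add: R_def field_simps)
        have "norm (x - t *\<^sub>R b) \<le> \<bar>r\<bar> + R * norm b"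
          using norm_triangle_ineq4[of x "t *\<^sub>R b"] x(2) mult_right_mono[OF tR, of "norm b"] by simp
        then show ?thesis
          using t tR by (auto simp: K_def intro!: image_eqI[of _ _ "(t, x - t *\<^sub>R b)"])
      qed
      ultimately show ?thesis by auto
    qed
    ultimately show ?thesis by (simp add: compact_Int_closed)
  qed
qed

section \<open>Finite-dimensional subspaces\<close>

text \<open>A point that is not the only solution of its active constraints lies on a segment of the set
  whose end points have more active constraints.\<close>

lemma polytope_finite_constraints:
  fixes F :: "'a::real_vector set" and G :: "('a \<Rightarrow> real) set"
  assumes F: "subspace F" and G: "finite G" "\<And>g. g \<in> G \<Longrightarrow> linear g"
    and bounded: "\<And>d. d \<in> F \<Longrightarrow> d \<noteq> 0 \<Longrightarrow> \<exists>g\<in>G. 0 < g d"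
  shows "polytope {x \<in> F. \<forall>g\<in>G. g x \<le> 1}" (is "polytope ?P")
proof -
  define act where "act x = {g \<in> G. g x = 1}" for x
  define V where "V = {x \<in> ?P. \<forall>y\<in>F. (\<forall>g\<in>act x. g y = 1) \<longrightarrow> y = x}"
  have lin: "g (x + t *\<^sub>R d) = g x + t * g d" if "g \<in> G" for g x t d
    using G(2)[OF that] by (simp add: linear_add linear_scale)
  \<comment> \<open>The points of \<open>V\<close> are the vertices. Each is determined by its
    active constraints, and \<open>G\<close> has only finitely many subsets.\<close>
  have "inj_on act V"
  proof (rule inj_onI)
    fix x y assume xy: "x \<in> V" "y \<in> V" "act x = act y"
    have "y \<in> F" using xy(2) by (simp add: V_def)
    moreover have "\<forall>g\<in>act x. g y = 1" unfolding xy(3) by (simp add: act_def)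
    moreover have "\<forall>y\<in>F. (\<forall>g\<in>act x. g y = 1) \<longrightarrow> y = x" using xy(1) by (simp add: V_def)
    ultimately show "x = y" by metis
  qed
  moreover have "finite (act ` V)"
    by (rule finite_subset[of _ "Pow G"]) (use G(1) in \<open>auto simp: act_def\<close>)
  ultimately have "finite V" by (rule finite_imageD[rotated])
  have "convex ?P"
    using F G(2) by (auto simp: convex_def subspace_add subspace_scale linear_add linear_scale
        intro!: convex_bound_le)
  then have "convex hull V \<subseteq> ?P" by (intro hull_minimal) (auto simp: V_def)
  have step: "\<exists>t>0. x + t *\<^sub>R d \<in> ?P \<and> act x \<subset> act (x + t *\<^sub>R d)"
    if x: "x \<in> ?P" and d: "d \<in> F" "d \<noteq> 0" "\<And>g. g \<in> act x \<Longrightarrow> g d = 0" for x d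
  proof -
    define S where "S = {g \<in> G. 0 < g d}"
    have S: "finite S" "S \<noteq> {}" using bounded[OF d(1,2)] G(1) by (auto simp: S_def)
    \<comment> \<open>The first parameter at which a constraint increasing along \<open>d\<close>
      becomes active; \<open>bounded\<close> guarantees that there is one.\<close>
    define t where "t = Min ((\<lambda>g. (1 - g x) / g d) ` S)"
    have "t \<in> (\<lambda>g. (1 - g x) / g d) ` S" unfolding t_def using S by (intro Min_in) auto
    then obtain g0 where g0: "g0 \<in> S" "t = (1 - g0 x) / g0 d" by auto
    have "g x < 1" if "g \<in> S" for g
      using that x d(3)[of g] by (force simp: S_def act_def order_less_le)
    then have "0 < t" using g0 by (simp add: S_def)
    have le: "g (x + t *\<^sub>R d) \<le> 1" if g: "g \<in> G" for g
    proof (cases "g \<in> S")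
      case True
      then have "t \<le> (1 - g x) / g d" unfolding t_def using S by (intro Min_le) auto
      then show ?thesis using True by (simp add: lin S_def field_simps)
    next
      case False
      then have "t * g d \<le> 0" using g \<open>0 < t\<close> by (simp add: S_def mult_nonneg_nonpos)
      then show ?thesis using x g by (fastforce simp: lin)
    qed
    have "g0 \<in> act (x + t *\<^sub>R d)" using g0 by (simp add: act_def lin S_def)
    moreover have "g0 \<notin> act x" using g0(1) d(3)[of g0] by (auto simp: S_def)
    moreover have "act x \<subseteq> act (x + t *\<^sub>R d)" using d(3) by (auto simp: act_def lin)
    ultimately have "act x \<subset> act (x + t *\<^sub>R d)" by auto
    then show ?thesis
      using \<open>0 < t\<close> le x d(1) F by (auto simp: subspace_add subspace_scale)
  qed
  have hull: "x \<in> ?P \<Longrightarrow> x \<in> convex hull V" for x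
  proof (induction "card (G - act x)" arbitrary: x rule: less_induct)
    case less
    show ?case
    proof (cases "x \<in> V")
      case True
      then show ?thesis by (rule hull_inc)
    next
      case False
      then obtain y where y: "y \<in> F" "\<forall>g\<in>act x. g y = 1" "y \<noteq> x"
        using less.prems by (auto simp: V_def)
      have d: "y - x \<in> F" "y - x \<noteq> 0" using y less.prems F by (auto simp: subspace_diff)
      have z: "g (y - x) = 0" if "g \<in> act x" for g
        using that y(2) G(2) by (auto simp: act_def linear_diff)
      have smaller: "card (G - act u) < card (G - act x)" if "act x \<subset> act u" for u
        using that G(1) by (intro psubset_card_mono) (auto simp: act_def)
      obtain t where t: "t > 0" "x + t *\<^sub>R (y - x) \<in> ?P" "act x \<subset> act (x + t *\<^sub>R (y - x))"
        using step[OF less.prems d] z by auto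
      have zn: "g (- (y - x)) = 0" if "g \<in> act x" for g
        using z[OF that] that G(2) by (simp add: act_def linear_diff)
      obtain s where s: "s > 0" "x + s *\<^sub>R (- (y - x)) \<in> ?P" "act x \<subset> act (x + s *\<^sub>R (- (y - x)))"
        using step[OF less.prems subspace_neg[OF F d(1)]] d(2) zn by auto
      have u: "x + t *\<^sub>R (y - x) \<in> convex hull V" "x + s *\<^sub>R (- (y - x)) \<in> convex hull V"
        using less.hyps[OF smaller[OF t(3)] t(2)] less.hyps[OF smaller[OF s(3)] s(2)] by simp_all
      \<comment> \<open>Weights that place \<open>x\<close> between the two new points: the
        contributions of \<open>y - x\<close> cancel.\<close>
      define a b where "a = s / (s + t)" and "b = t / (s + t)"
      have ab: "0 \<le> a" "0 \<le> b" "a + b = 1" "a * t = b * s"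
        using s t by (simp_all add: a_def b_def divide_simps)
      have "a *\<^sub>R (x + t *\<^sub>R (y - x)) + b *\<^sub>R (x + s *\<^sub>R (- (y - x)))
          = (a + b) *\<^sub>R x + (a * t - b * s) *\<^sub>R (y - x)"
        by (simp add: algebra_simps)
      also have "\<dots> = x" using ab by simp
      finally show ?thesis
        using convexD[OF convex_convex_hull u ab(1-3)] by simp
    qed
  qed
  have "?P = convex hull V" using hull \<open>convex hull V \<subseteq> ?P\<close> by blast
  then show ?thesis using \<open>finite V\<close> unfolding polytope_def by blast
qed

section \<open>Sublinear functionals as a source of linear ones\<close>

definition sublinear :: "('a::real_vector \<Rightarrow> real) \<Rightarrow> bool" where
  "sublinear p \<longleftrightarrow> (\<forall>x y. p (x + y) \<le> p x + p y) \<and> (\<forall>c x. 0 \<le> c \<longrightarrow> p (c *\<^sub>R x) = c * p x)"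

lemma sublinearD:
  assumes "sublinear p"
  shows sublinear_add: "p (x + y) \<le> p x + p y"
    and sublinear_scale: "0 \<le> c \<Longrightarrow> p (c *\<^sub>R x) = c * p x"
    and sublinear_zero: "p 0 = 0"
    and sublinear_minus: "- p x \<le> p (- x)"
proof -
  have a: "p (x + y) \<le> p x + p y" and s: "0 \<le> c \<Longrightarrow> p (c *\<^sub>R x) = c * p x" for x y c
    using assms by (auto simp: sublinear_def)
  show "p (x + y) \<le> p x + p y" "0 \<le> c \<Longrightarrow> p (c *\<^sub>R x) = c * p x" by (fact a s)+
  show 0: "p 0 = 0" using s[of 0 0] by simp
  show "- p x \<le> p (- x)" using a[of x "-x"] 0 by simp
qed

lemma is_norm_sublinear: "is_norm N \<Longrightarrow> sublinear N"
  by (auto simp: sublinear_def is_norm_def)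

text \<open>Oddness forces equality in the subadditivity of \<open>p\<close>, so \<open>p\<close> is
  linear on this set. It is therefore enough to arrange oddness on a spanning set.\<close>

lemma subspace_sublinear_odd:
  assumes "sublinear p"
  shows "subspace {v. p (- v) = - p v}"
proof (rule subspaceI; clarsimp)
  note p = sublinearD[OF assms]
  show "p 0 = 0" by (rule p)
  show "p (- x - y) = - p (x + y)" if "p (- x) = - p x" "p (- y) = - p y" for x y
    using p(1)[of x y] p(1)[of "-x" "-y"] p(4)[of "x + y"] that by simp
  show "p (- (c *\<^sub>R x)) = - p (c *\<^sub>R x)" if x: "p (- x) = - p x" for c x
  proof (cases "0 \<le> c")
    case True
    then show ?thesis using p(2)[OF True, of "-x"] p(2)[OF True, of x] x by simp
  next
    case False
    then show ?thesis using p(2)[of "-c" "-x"] p(2)[of "-c" x] x by simp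
  qed
qed

lemma sublinear_odd_add:
  assumes "sublinear p" "p (- x) = - p x" "p (- y) = - p y"
  shows "p (x + y) = p x + p y"
  using sublinearD(1)[OF assms(1), of x y] sublinearD(1)[OF assms(1), of "-x" "-y"]
    sublinearD(4)[OF assms(1), of "x + y"] assms(2,3) by simp

lemma sublinear_odd_scale:
  assumes "sublinear p" "p (- x) = - p x"
  shows "p (c *\<^sub>R x) = c * p x"
proof (cases "0 \<le> c")
  case True
  then show ?thesis using assms by (simp add: sublinear_scale)
next
  case False
  then show ?thesis using sublinear_scale[OF assms(1), of "-c" "-x"] assms(2) by simp
qed

text \<open>Squeezing: \<open>- q v <= q (- v) <= p (- v) = - p v\<close>, so \<open>q v\<close>
  cannot drop below \<open>p v\<close>. Oddness once gained survives every further decrease of the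
  functional.\<close>

lemma sublinear_odd_mono:
  assumes "sublinear q" "\<And>x. q x \<le> p x" "p (- v) = - p v"
  shows "q v = p v" "q (- v) = - q v"
  using assms(2)[of v] assms(2)[of "-v"] assms(3) sublinear_minus[OF assms(1), of v] by auto

text \<open>A finite-dimensional substitute for the Hahn-Banach theorem: \<open>q\<close> is the largest sublinear
  functional below \<open>p\<close> with \<open>q (- v) \<le> - p v\<close>.\<close>

lemma sublinear_make_odd:
  assumes p: "sublinear p"
  obtains q where "sublinear q" "\<And>x. q x \<le> p x" "q v = p v" "q (- v) = - q v"
proof -
  \<comment> \<open>The infimum over \<open>t\<close> is forced: an admissible \<open>q\<close>
    satisfies \<open>q z <= q (z + t v) + t q (- v) <= T z t\<close> for all
    \<open>t >= 0\<close>.\<close>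
  define T where "T z t = p (z + t *\<^sub>R v) - t * p v" for z t
  define q where "q z = (INF t\<in>{0..}. T z t)" for z
  have low: "- p (- z) \<le> T z t" if "0 \<le> t" for z t
    using sublinear_add[OF p, of "z + t *\<^sub>R v" "-z"] sublinear_scale[OF p that, of v]
    by (simp add: T_def)
  have q_le: "q z \<le> T z t" if "0 \<le> t" for z t
    unfolding q_def by (rule cINF_lower) (use low that in \<open>auto intro!: bdd_belowI2[of _ "- p (- z)"]\<close>)
  have le_q: "a \<le> q z" if "\<And>t. 0 \<le> t \<Longrightarrow> a \<le> T z t" for a z
    unfolding q_def by (rule cINF_greatest) (use that in auto)
  have qp: "q z \<le> p z" for z using q_le[of 0 z] by (simp add: T_def)
  have add: "q (x + y) \<le> q x + q y" for x y
  proof -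
    have "q (x + y) \<le> T x t + T y s" if "0 \<le> t" "0 \<le> s" for s t
      using q_le[of "t + s" "x + y"] sublinear_add[OF p, of "x + t *\<^sub>R v" "y + s *\<^sub>R v"] that
      by (simp add: T_def algebra_simps)
    then have "q (x + y) - T x t \<le> q y" if "0 \<le> t" for t
      using that by (intro le_q) (simp add: algebra_simps)
    then have "q (x + y) - q y \<le> q x" by (intro le_q) (simp add: algebra_simps)
    then show ?thesis by simp
  qed
  have scale_le: "q (c *\<^sub>R z) \<le> c * q z" if c: "0 < c" for c z
  proof -
    have "q (c *\<^sub>R z) / c \<le> q z"
    proof (rule le_q)
      fix t :: real assume "0 \<le> t"
      then have "q (c *\<^sub>R z) \<le> T (c *\<^sub>R z) (c * t)" using c by (intro q_le) simp
      also have "\<dots> = c * T z t"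
        using sublinear_scale[OF p, of c "z + t *\<^sub>R v"] c by (simp add: T_def algebra_simps)
      finally show "q (c *\<^sub>R z) / c \<le> T z t" using c by (simp add: field_simps)
    qed
    then show ?thesis using c by (simp add: field_simps)
  qed
  have q0: "q 0 = 0"
    using qp[of 0] sublinear_zero[OF p] le_q[of 0 0] sublinear_scale[OF p] by (fastforce simp: T_def)
  have scale: "q (c *\<^sub>R z) = c * q z" if "0 \<le> c" for c z
  proof (cases "c = 0")
    case False
    then have c: "0 < c" using that by simp
    have "q z \<le> inverse c * q (c *\<^sub>R z)"
      using scale_le[of "inverse c" "c *\<^sub>R z"] c by simp
    then have "c * q z \<le> q (c *\<^sub>R z)" using c by (simp add: field_simps)
    then show ?thesis using scale_le[OF c, of z] by simp
  qed (simp add: q0)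
  have sub: "sublinear q" using add scale by (simp add: sublinear_def)
  have "q (- v) \<le> - p v" using q_le[of 1 "-v"] sublinear_zero[OF p] by (simp add: T_def)
  then have "q v = p v" "q (- v) = - q v"
    using sublinear_minus[OF sub, of v] qp[of v] by auto
  then show thesis using that sub qp by blast
qed

lemma sublinear_make_odd_on:
  assumes "finite S" "sublinear p"
  obtains q where "sublinear q" "\<And>x. q x \<le> p x" "\<And>v. v \<in> S \<Longrightarrow> q (- v) = - q v"
  using assms
proof (induction S arbitrary: thesis rule: finite_induct)
  case empty
  then show ?case by blast
next
  case (insert v S)
  obtain q where q: "sublinear q" "\<And>x. q x \<le> p x" "\<And>v. v \<in> S \<Longrightarrow> q (- v) = - q v"
    using insert.IH insert.prems(2) by blast
  obtain r where r: "sublinear r" "\<And>x. r x \<le> q x" "r (- v) = - r v"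
    using sublinear_make_odd[OF q(1)] by metis
  show ?case
  proof (rule insert.prems(1))
    show "sublinear r" by fact
    show "r x \<le> p x" for x using q(2) r(2) order_trans by blast
    show "u \<in> insert v S \<Longrightarrow> r (- u) = - r u" for u
      using r(3) sublinear_odd_mono(2)[OF r(1,2)] q(3) by blast
  qed
qed

text \<open>Each \<open>z\<close> has a sublinear minorant of \<open>N\<close> that attains
  \<open>N\<close> at \<open>z\<close> and is odd on \<open>span B\<close>; composed with
  \<open>P\<close>, whose values lie there, it is linear on the whole space. It nearly norms a
  neighbourhood of \<open>z\<close>, and finitely many neighbourhoods cover the compact unit sphere
  of \<open>span B\<close>.\<close>

lemma finite_norming_functionals:
  fixes N :: "'a::real_normed_vector \<Rightarrow> real" and P :: "'a \<Rightarrow> 'a"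
  assumes N: "is_norm N" "equivalent_norms norm N"
    and B: "finite B" and P: "linear P" "\<And>x. P x \<in> span B" and "0 < \<epsilon>" "\<epsilon> < 1"
  obtains A where "finite A" "A \<noteq> {}" "\<And>g. g \<in> A \<Longrightarrow> linear g"
    "\<And>g x. g \<in> A \<Longrightarrow> g x \<le> N (P x)"
    "\<And>x. \<exists>g\<in>A. (1 - \<epsilon>) * N (P x) \<le> g x"
proof -
  have "\<exists>p. sublinear p \<and> (\<forall>x. p x \<le> N x) \<and> p z = N z \<and> (\<forall>v\<in>span B. p (- v) = - p v)" for z
  proof -
    \<comment> \<open>Oddness at \<open>z\<close> comes before oddness on \<open>B\<close>, so that
      the value \<open>N z\<close> is protected when the functional is decreased further.\<close>
    obtain q where q: "sublinear q" "\<And>x. q x \<le> N x" "q z = N z" "q (- z) = - q z"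
      using sublinear_make_odd[OF is_norm_sublinear[OF N(1)]] by metis
    obtain p where p: "sublinear p" "\<And>x. p x \<le> q x" "\<And>v. v \<in> B \<Longrightarrow> p (- v) = - p v"
      using sublinear_make_odd_on[OF B q(1)] by blast
    have "span B \<subseteq> {v. p (- v) = - p v}"
      using p(3) by (intro span_minimal subspace_sublinear_odd p(1)) auto
    then have "\<forall>v\<in>span B. p (- v) = - p v" by blast
    moreover have "p z = N z" using sublinear_odd_mono(1)[OF p(1,2) q(4)] q(3) by simp
    moreover have "\<forall>x. p x \<le> N x" using p(2) q(2) order_trans by blast
    ultimately show ?thesis using p(1) by blast
  qed
  then obtain p where p: "\<And>z. sublinear (p z)" "\<And>z x. p z x \<le> N x" "\<And>z. p z z = N z"
    "\<And>z v. v \<in> span B \<Longrightarrow> p z (- v) = - p z v"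
    by metis
  obtain c C where C: "c > 0" "\<And>x. c * norm x \<le> N x" "\<And>x. N x \<le> C * norm x"
    using equivalent_norms_normE[OF N(2)] by metis
  have cont: "continuous_on UNIV (p z)" for z
  proof (rule lipschitz_continuous_on)
    show "p z x - p z y \<le> C * norm (x - y)" for x y
      using sublinear_add[OF p(1), of z "x - y" y] p(2)[of z "x - y"] C(3)[of "x - y"] by simp
  qed
  define U where "U z = {x. (1 - \<epsilon>) * N x < p z x}" for z
  define S where "S = {x \<in> span B. norm x = 1}"
  have "closed {x :: 'a. norm x = 1}" by (intro closed_Collect_eq continuous_intros)
  moreover have "S = (span B \<inter> cball 0 1) \<inter> {x. norm x = 1}" by (auto simp: S_def)
  ultimately have "compact S" using compact_span_cball[OF B] by (simp add: compact_Int_closed)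
  moreover have "open (U z)" for z
    unfolding U_def
    by (intro open_Collect_less continuous_intros cont equivalent_norm_continuous_on N)
  moreover have "z \<in> U z" if "z \<in> S" for z
  proof -
    have "0 < N z" using that by (intro is_norm_pos N) (auto simp: S_def)
    then show ?thesis using \<open>0 < \<epsilon>\<close> by (simp add: U_def p(3))
  qed
  ultimately obtain D where D: "D \<subseteq> S" "finite D" "S \<subseteq> (\<Union>z\<in>D. U z)"
    using compactE_image[of S S U] by (metis (no_types, lifting) UN_I subsetI)
  \<comment> \<open>The zero functional keeps \<open>A\<close> nonempty and serves the points with
    \<open>P x = 0\<close>.\<close>
  define A where "A = insert (\<lambda>x. 0) ((\<lambda>z x. p z (P x)) ` D)"
  show thesis
  proof (rule that)
    show "finite A" "A \<noteq> {}" using D(2) by (auto simp: A_def)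
    show "linear g" if "g \<in> A" for g
    proof -
      have "linear (\<lambda>x. p z (P x))" for z
        by (rule linearI)
          (simp_all add: linear_add[OF P(1)] linear_scale[OF P(1)] sublinear_odd_add
            sublinear_odd_scale p P(2))
      then show ?thesis using that by (auto simp: A_def linear_zero)
    qed
    show "g x \<le> N (P x)" if "g \<in> A" for g x
      using that p(2) is_norm_nonneg[OF N(1)] by (auto simp: A_def)
    show "\<exists>g\<in>A. (1 - \<epsilon>) * N (P x) \<le> g x" for x
    proof (cases "P x = 0")
      case True
      then show ?thesis by (intro bexI[of _ "\<lambda>x. 0"]) (auto simp: A_def is_norm_zero[OF N(1)])
    next
      case False
      define u where "u = (1 / norm (P x)) *\<^sub>R P x"
      have "u \<in> S" using False P(2) by (auto simp: u_def S_def intro!: span_scale)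
      then obtain z where z: "z \<in> D" "u \<in> U z" using D(3) by blast
      have "(1 - \<epsilon>) * (N (P x) / norm (P x)) < p z (P x) / norm (P x)"
        using z(2) sublinear_scale[OF p(1), of "1 / norm (P x)" z "P x"]
        by (simp add: U_def u_def is_norm_scale[OF N(1)])
      then have "(1 - \<epsilon>) * N (P x) \<le> p z (P x)"
        using False by (simp add: divide_less_cancel)
      then show ?thesis using z(1) by (auto simp: A_def)
    qed
  qed
qed

section \<open>Polyhedral norms from countably many functionals\<close>

definition sup_fun :: "'i set \<Rightarrow> ('i \<Rightarrow> 'a \<Rightarrow> real) \<Rightarrow> 'a \<Rightarrow> real" where
  "sup_fun I h x = (SUP i\<in>I. \<bar>h i x\<bar>)"

lemma sup_fun_norm:
  fixes h :: "'i \<Rightarrow> 'a::real_normed_vector \<Rightarrow> real"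
  assumes I: "I \<noteq> {}" and h: "\<And>i. i \<in> I \<Longrightarrow> linear (h i)"
    and upper: "\<And>i x. i \<in> I \<Longrightarrow> \<bar>h i x\<bar> \<le> C * norm x" "C > 0"
    and lower: "\<And>x. c * norm x \<le> sup_fun I h x" "c > 0"
  shows "is_norm (sup_fun I h)" and "equivalent_norms norm (sup_fun I h)"
    and "\<And>i x. i \<in> I \<Longrightarrow> \<bar>h i x\<bar> \<le> sup_fun I h x"
proof -
  have le: "\<bar>h i x\<bar> \<le> sup_fun I h x" if "i \<in> I" for i x
    unfolding sup_fun_def
    by (rule cSUP_upper[OF that]) (use upper in \<open>auto intro!: bdd_aboveI2\<close>)
  have least: "sup_fun I h x \<le> a" if "\<And>i. i \<in> I \<Longrightarrow> \<bar>h i x\<bar> \<le> a" for a x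
    unfolding sup_fun_def by (rule cSUP_least[OF I that])
  show "i \<in> I \<Longrightarrow> \<bar>h i x\<bar> \<le> sup_fun I h x" for i x by (rule le)
  have upp: "sup_fun I h x \<le> C * norm x" for x by (rule least) (rule upper)
  show "equivalent_norms norm (sup_fun I h)"
    unfolding equivalent_norms_def using lower upper(2) upp by blast
  have scale_le: "sup_fun I h (r *\<^sub>R x) \<le> \<bar>r\<bar> * sup_fun I h x" for r x
    by (rule least) (simp add: linear_scale[OF h] abs_mult le mult_left_mono)
  have scale: "sup_fun I h (r *\<^sub>R x) = \<bar>r\<bar> * sup_fun I h x" for r x
  proof (cases "r = 0")
    case True
    then show ?thesis using upp[of 0] lower(1)[of 0] by simp
  next
    case False
    have "\<bar>r\<bar> * sup_fun I h (inverse r *\<^sub>R (r *\<^sub>R x)) \<le> \<bar>r\<bar> * (\<bar>inverse r\<bar> * sup_fun I h (r *\<^sub>R x))"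
      by (intro mult_left_mono scale_le) simp
    also have "\<dots> = sup_fun I h (r *\<^sub>R x)" using False by simp
    finally show ?thesis using False scale_le[of r x] by simp
  qed
  have "sup_fun I h (x + y) \<le> sup_fun I h x + sup_fun I h y" for x y
  proof (rule least)
    fix i assume i: "i \<in> I"
    show "\<bar>h i (x + y)\<bar> \<le> sup_fun I h x + sup_fun I h y"
      using le[OF i, of x] le[OF i, of y] by (simp add: linear_add[OF h[OF i]])
  qed
  moreover have "sup_fun I h x = 0 \<longleftrightarrow> x = 0" for x
  proof
    assume "sup_fun I h x = 0"
    then show "x = 0" using lower(1)[of x] lower(2) by (simp add: mult_le_0_iff)
  qed (use upp[of 0] lower(1)[of 0] in simp)
  ultimately show "is_norm (sup_fun I h)" using scale by (simp add: is_norm_def)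
qed

text \<open>If near every nonzero point finitely many of the functionals dominate all the others, then
  by compactness finitely many suffice on each finite-dimensional subspace.\<close>

lemma polyhedral_norm_sup_fun:
  fixes h :: "'i \<Rightarrow> 'a::real_normed_vector \<Rightarrow> real"
  assumes norm: "is_norm (sup_fun I h)" and h: "\<And>i. i \<in> I \<Longrightarrow> linear (h i)"
    and le: "\<And>i x. i \<in> I \<Longrightarrow> \<bar>h i x\<bar> \<le> sup_fun I h x"
    and I: "I \<noteq> {}"
    and loc: "\<And>x. x \<noteq> 0 \<Longrightarrow> \<exists>J U. finite J \<and> J \<subseteq> I \<and> open U \<and> x \<in> U \<and>
      (\<forall>y\<in>U. \<forall>i\<in>I. \<exists>j\<in>J. \<bar>h i y\<bar> \<le> \<bar>h j y\<bar>)"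
  shows "polyhedral_norm (sup_fun I h)"
  unfolding polyhedral_norm_def
proof (intro allI impI)
  fix B :: "'a set" assume B: "finite B"
  define S where "S = {x \<in> span B. norm x = 1}"
  have "closed {x :: 'a. norm x = 1}" by (intro closed_Collect_eq continuous_intros)
  moreover have "S = (span B \<inter> cball 0 1) \<inter> {x. norm x = 1}" by (auto simp: S_def)
  ultimately have "compact S" using compact_span_cball[OF B] by (simp add: compact_Int_closed)
  obtain J U where JUall: "\<And>x. x \<noteq> 0 \<Longrightarrow> finite (J x) \<and> J x \<subseteq> I \<and> open (U x) \<and> x \<in> U x \<and>
      (\<forall>y\<in>U x. \<forall>i\<in>I. \<exists>j\<in>J x. \<bar>h i y\<bar> \<le> \<bar>h j y\<bar>)"
    using loc by metis
  then have JU: "finite (J x)" "J x \<subseteq> I" "open (U x)" "x \<in> U x"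
    "y \<in> U x \<Longrightarrow> i \<in> I \<Longrightarrow> \<exists>j\<in>J x. \<bar>h i y\<bar> \<le> \<bar>h j y\<bar>" if "x \<noteq> 0" for x y i
    using that by blast+
  have nz: "x \<noteq> 0" if "x \<in> S" for x using that by (auto simp: S_def)
  obtain D where D: "D \<subseteq> S" "finite D" "S \<subseteq> (\<Union>x\<in>D. U x)"
    using compactE_image[OF \<open>compact S\<close>, of S U] JU(3,4) nz by (metis (no_types, lifting) UN_I subsetI)
  define K where "K = (\<Union>x\<in>D. J x)"
  have K: "finite K" "K \<subseteq> I"
    using D JU(1,2) nz unfolding K_def by blast+
  have dom: "\<exists>j\<in>K. \<bar>h i x\<bar> \<le> \<bar>h j x\<bar>" if x: "x \<in> span B" "x \<noteq> 0" and i: "i \<in> I" for x i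
  proof -
    define u where "u = (1 / norm x) *\<^sub>R x"
    have "u \<in> S" using x by (auto simp: u_def S_def intro!: span_scale)
    then obtain d where d: "d \<in> D" "u \<in> U d" using D(3) by blast
    then obtain j where j: "j \<in> J d" "\<bar>h i u\<bar> \<le> \<bar>h j u\<bar>"
      using JU(5)[of d u i] nz D(1) i by blast
    have "j \<in> K" using j d by (auto simp: K_def)
    moreover have "\<bar>h i x\<bar> \<le> \<bar>h j x\<bar>"
      using j(2) x(2) \<open>j \<in> K\<close> K(2) h i
      by (simp add: u_def linear_scale abs_mult divide_le_cancel subset_iff)
    ultimately show ?thesis by blast
  qed
  \<comment> \<open>Both signs are needed because the constraints of the polytope are
    one-sided.\<close>
  define G where "G = h ` K \<union> (\<lambda>j x. - h j x) ` K"
  have "polytope {x \<in> span B. \<forall>g\<in>G. g x \<le> 1}"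
  proof (rule polytope_finite_constraints)
    show "finite G" using K by (simp add: G_def)
    show "linear g" if "g \<in> G" for g
      using that h K(2) by (auto simp: G_def intro!: linear_compose_neg)
    show "\<exists>g\<in>G. 0 < g d" if d: "d \<in> span B" "d \<noteq> 0" for d
    proof -
      have "\<exists>i\<in>I. h i d \<noteq> 0"
      proof (rule ccontr)
        assume "\<not> ?thesis"
        then have "sup_fun I h d = 0" using I by (simp add: sup_fun_def)
        then show False using d(2) norm by (simp add: is_norm_eq_0_iff)
      qed
      then obtain i where i: "i \<in> I" "h i d \<noteq> 0" by blast
      then obtain j where j: "j \<in> K" "\<bar>h i d\<bar> \<le> \<bar>h j d\<bar>" using dom d by blast
      then have "h j d > 0 \<or> - h j d > 0" using i by linarith
      moreover have "h j \<in> G" "(\<lambda>x. - h j x) \<in> G" using j(1) by (auto simp: G_def)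
      ultimately show ?thesis
        by (elim disjE) (rule bexI[of _ "h j"] bexI[of _ "\<lambda>x. - h j x"]; simp)+
    qed
  qed (rule subspace_span)
  moreover have "{x \<in> span B. sup_fun I h x \<le> 1} = {x \<in> span B. \<forall>g\<in>G. g x \<le> 1}"
  proof -
    have "sup_fun I h x \<le> 1 \<longleftrightarrow> (\<forall>g\<in>G. g x \<le> 1)" if x: "x \<in> span B" for x
    proof
      assume 1: "sup_fun I h x \<le> 1"
      have "\<bar>h j x\<bar> \<le> 1" if "j \<in> K" for j
        using le[of j x] 1 that K(2) by fastforce
      then show "\<forall>g\<in>G. g x \<le> 1" by (auto simp: G_def abs_le_iff)
    next
      assume G: "\<forall>g\<in>G. g x \<le> 1"
      show "sup_fun I h x \<le> 1"
      proof (cases "x = 0")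
        case True
        then show ?thesis using is_norm_zero[OF norm] by simp
      next
        case False
        have K1: "\<bar>h j x\<bar> \<le> 1" if "j \<in> K" for j
        proof -
          have "h j \<in> G" "(\<lambda>x. - h j x) \<in> G" using that by (auto simp: G_def)
          from this[THEN G[rule_format]] show ?thesis by (simp add: abs_le_iff)
        qed
        have "\<bar>h i x\<bar> \<le> 1" if "i \<in> I" for i
          using dom[OF x False that] K1 order_trans by blast
        then show ?thesis unfolding sup_fun_def by (intro cSUP_least I)
      qed
    qed
    then show ?thesis by blast
  qed
  ultimately show "polytope {x \<in> span B. sup_fun I h x \<le> 1}" by simp
qed

text \<open>With \<open>w m = (m+2)/(m+1)\<close> and \<open>1 - \<epsilon> m = (m+2)/(m+3)\<close>
  the product is \<open>(m+2)^2 / ((m+1)(m+3))\<close>, and the denominator is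
  \<open>(m+2)^2 - 1\<close>. Both renormings use these weights: they outweigh the loss
  \<open>1 - \<epsilon> m\<close> strictly and still tend to 1.\<close>

lemma norming_weights:
  obtains w \<epsilon> :: "nat \<Rightarrow> real" where "\<And>m. 1 < w m" "\<And>m. w m \<le> 2" "\<And>m. 0 < \<epsilon> m" "\<And>m. \<epsilon> m < 1"
    "\<And>m. 1 < w m * (1 - \<epsilon> m)" "w \<longlonglongrightarrow> 1"
proof
  define \<epsilon> where "\<epsilon> m = 1 / (real m + 3)" for m
  define w where "w m = 1 + inverse (real (Suc m))" for m
  show "1 < w m" "w m \<le> 2" "0 < \<epsilon> m" "\<epsilon> m < 1" for m by (simp_all add: w_def \<epsilon>_def field_simps)
  show "1 < w m * (1 - \<epsilon> m)" for m
  proof -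
    have eq: "w m * (1 - \<epsilon> m) = (real m + 2) * (real m + 2) / ((real m + 1) * (real m + 3))"
      by (simp add: w_def \<epsilon>_def divide_simps) (simp add: algebra_simps)
    have "(real m + 1) * (real m + 3) < (real m + 2) * (real m + 2)"
      by (simp add: algebra_simps)
    then have "1 < (real m + 2) * (real m + 2) / ((real m + 1) * (real m + 3))"
      by (subst less_divide_eq_1_pos) simp_all
    then show ?thesis unfolding eq .
  qed
  show "w \<longlonglongrightarrow> 1" unfolding w_def by (rule LIMSEQ_inverse_real_of_nat_add)
qed

lemma polyhedral_renorming:
  fixes N :: "'a::real_normed_vector \<Rightarrow> real" and P :: "nat \<Rightarrow> 'a \<Rightarrow> 'a"
  assumes N: "is_norm N" "equivalent_norms norm N"
    and P: "\<And>m. linear (P m)" "\<And>m. \<exists>B. finite B \<and> (\<forall>x. P m x \<in> span B)"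
      "\<And>m x. N (P m x) \<le> N x" "\<And>x. \<forall>\<^sub>F m in sequentially. N (P m x) = N x"
  obtains M :: "'a \<Rightarrow> real" where "is_norm M" "equivalent_norms norm M" "polyhedral_norm M"
proof -
  obtain w \<epsilon> :: "nat \<Rightarrow> real" where w: "\<And>m. 1 < w m" "\<And>m. w m \<le> 2"
    and \<epsilon>: "\<And>m. 0 < \<epsilon> m" "\<And>m. \<epsilon> m < 1"
    and w\<epsilon>: "\<And>m. 1 < w m * (1 - \<epsilon> m)" and w_lim: "w \<longlonglongrightarrow> 1"
    using norming_weights by metis
  have "\<exists>A. finite A \<and> A \<noteq> {} \<and> (\<forall>g\<in>A. linear g) \<and> (\<forall>g\<in>A. \<forall>x. g x \<le> N (P m x)) \<and>
      (\<forall>x. \<exists>g\<in>A. (1 - \<epsilon> m) * N (P m x) \<le> g x)" for m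
  proof -
    obtain B where B: "finite B" "\<And>x. P m x \<in> span B" using P(2) by blast
    show ?thesis
    proof (rule finite_norming_functionals[OF N B(1) P(1) B(2) \<epsilon>])
      fix A :: "('a \<Rightarrow> real) set"
      assume "finite A" "A \<noteq> {}" "\<And>g. g \<in> A \<Longrightarrow> linear g"
        "\<And>g x. g \<in> A \<Longrightarrow> g x \<le> N (P m x)"
        "\<And>x. \<exists>g\<in>A. (1 - \<epsilon> m) * N (P m x) \<le> g x"
      then show ?thesis by (intro exI[of _ A] conjI ballI allI)
    qed
  qed
  then obtain A where A: "\<And>m. finite (A m)" "\<And>m. A m \<noteq> {}" "\<And>m g. g \<in> A m \<Longrightarrow> linear g"
    "\<And>m g x. g \<in> A m \<Longrightarrow> g x \<le> N (P m x)" "\<And>m x. \<exists>g\<in>A m. (1 - \<epsilon> m) * N (P m x) \<le> g x"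
    by metis
  define I where "I = (SIGMA m:UNIV. A m)"
  define h :: "nat \<times> ('a \<Rightarrow> real) \<Rightarrow> 'a \<Rightarrow> real" where "h = (\<lambda>(m, g) x. w m * g x)"
  define M where "M = sup_fun I h"
  obtain c C where C: "c > 0" "C > 0" "\<And>x. c * norm x \<le> N x" "\<And>x. N x \<le> C * norm x"
    using equivalent_norms_normE[OF N(2)] by metis
  have I: "I \<noteq> {}" using A(2) by (auto simp: I_def)
  have lin: "linear (h i)" if "i \<in> I" for i
    using that A(3) by (auto simp: I_def h_def intro!: linearI simp: linear_add linear_scale algebra_simps)
  have absg: "\<bar>g x\<bar> \<le> N x" if "g \<in> A m" for m g x
    using A(4)[OF that, of x] A(4)[OF that, of "-x"] P(3)[of m x] P(3)[of m "-x"] linear_neg[OF A(3)[OF that], of x]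
    by (simp add: is_norm_minus[OF N(1)])
  have upper: "\<bar>h i x\<bar> \<le> (2 * C) * norm x" if iI: "i \<in> I" for i x
  proof -
    obtain m g where i: "i = (m, g)" "g \<in> A m" using iI by (auto simp: I_def)
    have "\<bar>h i x\<bar> = w m * \<bar>g x\<bar>" using w(1)[of m] by (simp add: i h_def abs_mult)
    also have "\<dots> \<le> 2 * N x"
      using w[of m] absg[OF i(2), of x] by (intro mult_mono) auto
    finally show ?thesis using C(4)[of x] by simp
  qed
  \<comment> \<open>At a level \<open>m\<close> where \<open>P m x\<close> already has the norm of
    \<open>x\<close>, the weight more than repays the loss \<open>1 - \<epsilon> m\<close>.\<close>
  have attained: "\<exists>i\<in>I. N x < \<bar>h i x\<bar>" if "x \<noteq> 0" for x
  proof -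
    obtain m where m: "N (P m x) = N x"
      using P(4)[of x] by (auto simp: eventually_sequentially)
    obtain g where g: "g \<in> A m" "(1 - \<epsilon> m) * N (P m x) \<le> g x" using A(5) by blast
    have "N x < w m * (1 - \<epsilon> m) * N x"
      using w\<epsilon>[of m] is_norm_pos[OF N(1) that] by simp
    also have "\<dots> \<le> w m * g x" using g(2) w(1)[of m] m by (simp add: mult.assoc)
    finally show ?thesis using g(1) by (intro bexI[of _ "(m, g)"]) (auto simp: I_def h_def)
  qed
  have bdd: "bdd_above ((\<lambda>i. \<bar>h i x\<bar>) ` I)" for x
    using upper by (auto intro!: bdd_aboveI2)
  have lower: "c * norm x \<le> sup_fun I h x" for x
  proof (cases "x = 0")
    case True
    obtain i where "i \<in> I" using I by blast
    then have "\<bar>h i x\<bar> \<le> sup_fun I h x" unfolding sup_fun_def by (intro cSUP_upper bdd)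
    then show ?thesis using True by simp
  next
    case False
    obtain i where "i \<in> I" "N x < \<bar>h i x\<bar>" using attained[OF False] by blast
    moreover from this have "\<bar>h i x\<bar> \<le> sup_fun I h x" unfolding sup_fun_def by (intro cSUP_upper bdd)
    ultimately show ?thesis using C(3)[of x] by simp
  qed
  have C2: "0 < 2 * C" using C by simp
  have sn: "is_norm M" "equivalent_norms norm M" "i \<in> I \<Longrightarrow> \<bar>h i x\<bar> \<le> M x" for i x
    unfolding M_def
    by (rule sup_fun_norm[of I h "2 * C" c]; use I lin upper C2 lower C(1) in blast)+
  have "polyhedral_norm M"
    unfolding M_def
  proof (rule polyhedral_norm_sup_fun)
    show "is_norm (sup_fun I h)" using sn(1) by (simp add: M_def)
    show "\<bar>h i x\<bar> \<le> sup_fun I h x" if "i \<in> I" for i x using sn(3)[OF that] by (simp add: M_def)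
    fix x :: 'a assume "x \<noteq> 0"
    then obtain i where i: "i \<in> I" "N x < \<bar>h i x\<bar>" using attained by blast
    have Nx: "0 < N x" by (rule is_norm_pos[OF N(1) \<open>x \<noteq> 0\<close>])
    \<comment> \<open>The number \<open>a\<close> separates \<open>h i\<close> from the tail:
      functionals of weight below \<open>a\<close> are at most \<open>a * N\<close>, which lies
      below \<open>|h i|\<close> on the open set \<open>U\<close>. Only \<open>i\<close> and the
      finitely many functionals of levels below \<open>m0\<close> remain.\<close>
    obtain a where a: "1 < a" "a * N x < \<bar>h i x\<bar>"
      using dense[of 1 "\<bar>h i x\<bar> / N x"] i(2) Nx by (auto simp: field_simps)
    have "\<forall>\<^sub>F m in sequentially. w m < a" using order_tendstoD(2)[OF w_lim a(1)] .
    then obtain m0 where m0: "\<And>m. m0 \<le> m \<Longrightarrow> w m < a" by (auto simp: eventually_sequentially)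
    define J where "J = insert i (SIGMA m:{..<m0}. A m)"
    define U where "U = {y. a * N y < \<bar>h i y\<bar>}"
    have "finite J" "J \<subseteq> I" using A(1) i(1) by (auto simp: J_def I_def)
    moreover have "open U"
      unfolding U_def
      by (intro open_Collect_less continuous_intros equivalent_norm_continuous_on N
          linear_bounded_continuous_on[OF lin upper] i(1))
    moreover have "x \<in> U" using a(2) by (simp add: U_def)
    moreover have dom: "\<exists>j\<in>J. \<bar>h k y\<bar> \<le> \<bar>h j y\<bar>" if y: "y \<in> U" and k: "k \<in> I" for y k
    proof -
      obtain m g where mg: "k = (m, g)" "g \<in> A m" using k by (auto simp: I_def)
      show ?thesis
      proof (cases "m < m0")
        case True
        then show ?thesis using mg by (auto simp: J_def)
      next
        case False
        have "\<bar>h k y\<bar> = w m * \<bar>g y\<bar>" using w(1)[of m] by (simp add: mg h_def abs_mult)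
        also have "\<dots> \<le> a * N y"
          using w(1)[of m] m0[of m] False absg[OF mg(2), of y] a(1) by (intro mult_mono) auto
        also have "\<dots> \<le> \<bar>h i y\<bar>" using y by (simp add: U_def)
        finally show ?thesis by (auto simp: J_def)
      qed
    qed
    ultimately show "\<exists>J U. finite J \<and> J \<subseteq> I \<and> open U \<and> x \<in> U \<and>
      (\<forall>y\<in>U. \<forall>i\<in>I. \<exists>j\<in>J. \<bar>h i y\<bar> \<le> \<bar>h j y\<bar>)"
      by (intro exI[of _ J] exI[of _ U] conjI ballI) (assumption | rule dom)+
  qed (use lin I in auto)
  then show thesis using that sn(1,2) by blast
qed

section \<open>Projections of a Schauder basis\<close>

lemma basis_coeff_sums:
  assumes "schauder_basis e"
  shows "(\<lambda>n. basis_coeff e x n *\<^sub>R e n) sums x"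
  using theI'[OF assms[unfolded schauder_basis_def, rule_format, of x]]
  by (simp add: basis_coeff_def)

lemma basis_coeff_unique:
  assumes "schauder_basis e" "(\<lambda>n. a n *\<^sub>R e n) sums x"
  shows "basis_coeff e x = a"
  using basis_coeff_sums[OF assms(1), of x] assms unfolding schauder_basis_def by blast

lemma basis_coeff_add:
  assumes "schauder_basis e"
  shows "basis_coeff e (x + y) n = basis_coeff e x n + basis_coeff e y n"
  using basis_coeff_unique[OF assms, of "\<lambda>n. basis_coeff e x n + basis_coeff e y n" "x + y"]
    sums_add[OF basis_coeff_sums[OF assms, of x] basis_coeff_sums[OF assms, of y]]
  by (simp add: scaleR_left_distrib)

lemma basis_coeff_scaleR:
  assumes "schauder_basis e"
  shows "basis_coeff e (c *\<^sub>R x) n = c * basis_coeff e x n"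
  using basis_coeff_unique[OF assms, of "\<lambda>n. c * basis_coeff e x n" "c *\<^sub>R x"]
    sums_scaleR_right[OF basis_coeff_sums[OF assms, of x], of c]
  by simp

lemma linear_basis_proj:
  assumes "schauder_basis e"
  shows "linear (basis_proj e k)"
  by (rule linearI)
    (simp_all add: basis_proj_def basis_coeff_add[OF assms] basis_coeff_scaleR[OF assms]
      scaleR_left_distrib sum.distrib scaleR_sum_right)

lemma basis_coeff_finite_sum:
  assumes "schauder_basis e"
  shows "basis_coeff e (\<Sum>n\<le>k. a n *\<^sub>R e n) = (\<lambda>n. if n \<le> k then a n else 0)"
proof (rule basis_coeff_unique[OF assms])
  have "(\<lambda>n. (if n \<le> k then a n else 0) *\<^sub>R e n) sums (\<Sum>n\<le>k. (if n \<le> k then a n else 0) *\<^sub>R e n)"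
    by (rule sums_finite) auto
  then show "(\<lambda>n. (if n \<le> k then a n else 0) *\<^sub>R e n) sums (\<Sum>n\<le>k. a n *\<^sub>R e n)"
    by simp
qed

lemma basis_proj_finite_sum:
  assumes "schauder_basis e"
  shows "basis_proj e j (\<Sum>n\<le>k. a n *\<^sub>R e n) = (\<Sum>n\<le>min j k. a n *\<^sub>R e n)"
proof -
  have "basis_proj e j (\<Sum>n\<le>k. a n *\<^sub>R e n) = (\<Sum>n\<le>j. (if n \<le> k then a n *\<^sub>R e n else 0))"
    by (auto simp: basis_proj_def basis_coeff_finite_sum[OF assms] intro!: sum.cong)
  also have "\<dots> = (\<Sum>n\<in>{..j} \<inter> {n. n \<le> k}. a n *\<^sub>R e n)"
    by (simp add: sum.inter_restrict[symmetric] sum.If_cases)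
  also have "{..j} \<inter> {n. n \<le> k} = {..min j k}" by auto
  finally show ?thesis .
qed

lemma basis_proj_proj:
  assumes "schauder_basis e"
  shows "basis_proj e j (basis_proj e k x) = basis_proj e (min j k) x"
  using basis_proj_finite_sum[OF assms, of j "basis_coeff e x" k] by (simp add: basis_proj_def)

lemma basis_proj_tendsto:
  assumes "schauder_basis e"
  shows "(\<lambda>k. basis_proj e k x) \<longlonglongrightarrow> x"
  using basis_coeff_sums[OF assms, of x] by (simp add: basis_proj_def sums_def_le)

text \<open>Otherwise altering the coefficient of \<open>e n\<close> would produce a second
  expansion of 0.\<close>

lemma basis_nonzero:
  assumes "schauder_basis e"
  shows "e n \<noteq> 0"
proof
  assume "e n = 0"
  then have "(\<lambda>i. (if i = n then 1 else 0) *\<^sub>R e i) = (\<lambda>i. 0)" by auto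
  then have "(\<lambda>i. (if i = n then 1 else 0) *\<^sub>R e i) sums 0" by simp
  from basis_coeff_unique[OF assms this] basis_coeff_unique[OF assms, of "\<lambda>i. 0" 0]
  have "(\<lambda>i. if i = n then 1 else 0) = (\<lambda>i. 0 :: real)" by simp
  from fun_cong[OF this, of n] show False by simp
qed

section \<open>Boundedness of the partial sum projections\<close>

lemma summable_geometric_bound:
  fixes f :: "nat \<Rightarrow> 'a::banach"
  assumes "\<And>i. norm (f i) \<le> D * (1/2) ^ i"
  shows "summable f" "norm (suminf f) \<le> 2 * D"
proof -
  have g: "(\<lambda>i. D * (1/2) ^ i) sums (D * 2)"
    using sums_mult[OF geometric_sums[of "1/2 :: real"], of D] by simp
  show "summable f"
    by (rule summable_comparison_test'[OF sums_summable[OF g], of 0]) (rule assms)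
  have "norm (suminf f) \<le> (\<Sum>i. D * (1/2) ^ i)"
    by (rule norm_suminf_le[OF assms sums_summable[OF g]])
  then show "norm (suminf f) \<le> 2 * D" by (simp add: sums_unique[OF g, symmetric])
qed

text \<open>By Baire some closure of \<open>{v. \<forall>k. norm (P\<^sub>k v) \<le> n}\<close> contains a ball; differences and scaling give the approximation.\<close>

lemma basis_proj_approx:
  fixes e :: "nat \<Rightarrow> 'a::banach"
  assumes e: "schauder_basis e"
  obtains c where "0 < c" "\<And>x. \<exists>v. norm (x - v) \<le> norm x / 2 \<and> (\<forall>k. norm (basis_proj e k v) \<le> c * norm x)"
proof -
  \<comment> \<open>As long as the projections are not known to be bounded, \<open>V n\<close> is
    not known to be closed. Baire's theorem therefore speaks about its closure, and vectors are
    reached only approximately.\<close>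
  define V where "V n = {v. \<forall>k. norm (basis_proj e k v) \<le> real n}" for n
  have "(\<Union>n. closure (V n)) = UNIV"
  proof -
    have "\<exists>n. x \<in> V n" for x
    proof -
      have "Bseq (\<lambda>k. basis_proj e k x)"
        using basis_proj_tendsto[OF e, of x] by (intro convergent_imp_Bseq convergentI)
      then obtain K where K: "\<And>k. norm (basis_proj e k x) \<le> K" by (auto simp: Bseq_def)
      obtain n where "K \<le> real n" using real_arch_simple by blast
      then show ?thesis using K order_trans by (auto simp: V_def) blast
    qed
    then show ?thesis using closure_subset by blast
  qed
  then obtain n where "interior (closure (V n)) \<noteq> {}"
    using Baire_closed_union[of "\<lambda>n. closure (V n)"] closed_closure by metis
  then obtain y r where r: "0 < r" "ball y r \<subseteq> closure (V n)"
    by (metis all_not_in_conv interior_subset open_contains_ball open_interior subset_trans)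
  have approx: "\<exists>v. norm (x - v) < d \<and> (\<forall>k. norm (basis_proj e k v) \<le> 2 * real n)"
    if x: "norm x < r" and d: "0 < d" for x d
  proof -
    have "y + x \<in> closure (V n)" "y \<in> closure (V n)" using r x by (auto simp: dist_norm)
    then obtain u v where u: "u \<in> V n" "dist u (y + x) < d / 2" and v: "v \<in> V n" "dist v y < d / 2"
      using d unfolding closure_approachable by (meson half_gt_zero)
    have "norm (x - (u - v)) \<le> norm ((y + x) - u) + norm (v - y)"
      using norm_triangle_ineq[of "(y + x) - u" "v - y"] by (simp add: algebra_simps)
    also have "\<dots> < d" using u(2) v(2) by (simp add: dist_norm norm_minus_commute)
    finally have 1: "norm (x - (u - v)) < d" .
    have "norm (basis_proj e k (u - v)) \<le> 2 * real n" for k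
    proof -
      have "norm (basis_proj e k u) \<le> real n" "norm (basis_proj e k v) \<le> real n"
        using u(1) v(1) by (simp_all add: V_def)
      then show ?thesis
        using norm_triangle_ineq4[of "basis_proj e k u" "basis_proj e k v"]
        by (simp add: linear_diff[OF linear_basis_proj[OF e]])
    qed
    with 1 show ?thesis by blast
  qed
  \<comment> \<open>Rescaling \<open>x\<close> to norm \<open>r / 2\<close> multiplies the bound
    \<open>2 * n\<close> by \<open>2 * norm x / r\<close>; \<open>n + 1\<close> instead of
    \<open>n\<close> keeps \<open>c\<close> positive.\<close>
  define c where "c = 4 * (real n + 1) / r"
  show thesis
  proof (rule that[of c])
    show "0 < c" using r by (simp add: c_def add_nonneg_pos)
    fix x :: 'a
    show "\<exists>v. norm (x - v) \<le> norm x / 2 \<and> (\<forall>k. norm (basis_proj e k v) \<le> c * norm x)"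
    proof (cases "x = 0")
      case True
      then show ?thesis
        by (intro exI[of _ 0]) (simp add: linear_0[OF linear_basis_proj[OF e]])
    next
      case False
      define s where "s = r / (2 * norm x)"
      have s: "0 < s" using False r by (simp add: s_def)
      have "norm (s *\<^sub>R x) < r" using False r by (simp add: s_def)
      then obtain v where v: "norm (s *\<^sub>R x - v) < r / 4" "\<And>k. norm (basis_proj e k v) \<le> 2 * real n"
        using approx[of "s *\<^sub>R x" "r / 4"] r by auto
      define w where "w = (1 / s) *\<^sub>R v"
      have "s * norm (x - w) = norm (s *\<^sub>R (x - w))" using s by simp
      also have "s *\<^sub>R (x - w) = s *\<^sub>R x - v" using s by (simp add: w_def scaleR_diff_right)
      finally have "s * norm (x - w) < r / 4" using v(1) by simp
      then have "norm (x - w) \<le> norm x / 2" using False r by (simp add: s_def field_simps)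
      moreover have "norm (basis_proj e k w) \<le> c * norm x" for k
      proof -
        have "norm (basis_proj e k w) = norm (basis_proj e k v) / s"
          using s by (simp add: w_def linear_scale[OF linear_basis_proj[OF e]])
        also have "\<dots> \<le> 2 * real n / s" using s v(2) by (simp add: divide_right_mono)
        also have "\<dots> = 4 * real n / r * norm x" using False r by (simp add: s_def)
        also have "\<dots> \<le> c * norm x"
          using r unfolding c_def by (intro mult_right_mono divide_right_mono) auto
        finally show ?thesis .
      qed
      ultimately show ?thesis by blast
    qed
  qed
qed

text \<open>Banach's theorem, by expanding \<open>x\<close> into a series of vectors with controlled partial sum
  projections; uniqueness of the coefficients identifies the projections of \<open>x\<close>.\<close>

lemma basis_proj_bounded:
  fixes e :: "nat \<Rightarrow> 'a::banach"
  assumes e: "schauder_basis e"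
  obtains K where "0 < K" "\<And>k x. norm (basis_proj e k x) \<le> K * norm x"
proof -
  obtain c where c: "0 < c"
    "\<And>x. \<exists>v. norm (x - v) \<le> norm x / 2 \<and> (\<forall>k. norm (basis_proj e k v) \<le> c * norm x)"
    using basis_proj_approx[OF e] by metis
  obtain A where A: "\<And>x. norm (x - A x) \<le> norm x / 2" "\<And>x k. norm (basis_proj e k (A x)) \<le> c * norm x"
    using c(2) by metis
  note lin = linear_basis_proj[OF e]
  have "norm (basis_proj e k x) \<le> 2 * c * norm x" for k x
  proof -
    \<comment> \<open>Successive remainders: each is approximated by a vector with controlled
      projections, and what is left has at most half the norm.\<close>
    define r where "r i = ((\<lambda>y. y - A y) ^^ i) x" for i
    define v where "v i = A (r i)" for i
    have r_Suc: "r (Suc i) = r i - v i" for i by (simp add: r_def v_def)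
    have r: "norm (r i) \<le> norm x * (1/2) ^ i" for i
    proof (induction i)
      case (Suc i)
      then show ?case using A(1)[of "r i"] unfolding r_Suc v_def by simp
    qed (simp add: r_def)
    have v: "norm (basis_proj e k (v i)) \<le> (c * norm x) * (1/2) ^ i" for k i
      using order_trans[OF A(2) mult_left_mono[OF r]] c(1) by (simp add: v_def mult.assoc)
    have sum_v: "(\<Sum>i<m. v i) = x - r m" for m
      by (induction m) (simp_all add: r_Suc, simp add: r_def)
    define T where "T k = (\<Sum>i. basis_proj e k (v i))" for k
    have T: "norm (T k) \<le> 2 * (c * norm x)" for k
      unfolding T_def by (rule summable_geometric_bound(2)[OF v])
    \<comment> \<open>The projection is not yet known to be continuous and cannot be pulled through
      the series of the \<open>v i\<close>. The coefficients are summed instead, and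
      \<open>a\<close> is shown to be an expansion of \<open>x\<close>.\<close>
    define a where "a n = (\<Sum>i. basis_coeff e (v i) n)" for n
    \<comment> \<open>A coefficient is controlled by the difference of two consecutive projections,
      or by the projection of index 0, and by \<open>e n\<close> being nonzero.\<close>
    have coeff: "summable (\<lambda>i. basis_coeff e (v i) n)" for n
    proof -
      have "norm (basis_coeff e (v i) n *\<^sub>R e n) \<le> (2 * c * norm x) * (1/2) ^ i" for i
      proof (cases n)
        case 0
        then have "basis_coeff e (v i) n *\<^sub>R e n = basis_proj e 0 (v i)" by (simp add: basis_proj_def)
        then have "norm (basis_coeff e (v i) n *\<^sub>R e n) \<le> (c * norm x) * (1/2) ^ i"
          using v[of 0 i] by simp
        also have "\<dots> \<le> (2 * c * norm x) * (1/2) ^ i"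
          using c(1) by (intro mult_right_mono) auto
        finally show ?thesis .
      next
        case (Suc j)
        then have "basis_coeff e (v i) n *\<^sub>R e n = basis_proj e n (v i) - basis_proj e j (v i)"
          by (simp add: basis_proj_def)
        then show ?thesis
          using norm_triangle_ineq4[of "basis_proj e n (v i)" "basis_proj e j (v i)"] v[of n i] v[of j i]
          by simp
      qed
      then have "norm (basis_coeff e (v i) n) \<le> (2 * c * norm x / norm (e n)) * (1/2) ^ i" for i
        using basis_nonzero[OF e, of n] by (simp add: field_simps)
      then show ?thesis by (rule summable_geometric_bound(1))
    qed
    have T_eq: "T k = (\<Sum>n\<le>k. a n *\<^sub>R e n)" for k
    proof -
      have "(\<Sum>n\<le>k. a n *\<^sub>R e n) = (\<Sum>n\<le>k. \<Sum>i. basis_coeff e (v i) n *\<^sub>R e n)"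
        by (simp add: a_def suminf_scaleR_left[OF coeff])
      also have "\<dots> = T k"
        unfolding T_def basis_proj_def
        by (rule suminf_sum[symmetric]) (intro summable_scaleR_left coeff)
      finally show ?thesis by simp
    qed
    have tail: "norm (T k - basis_proj e k (x - r m)) \<le> 2 * (c * norm x * (1/2) ^ m)" for k m
    proof -
      have "T k = (\<Sum>i. basis_proj e k (v (i + m))) + (\<Sum>i<m. basis_proj e k (v i))"
        unfolding T_def by (rule suminf_split_initial_segment[OF summable_geometric_bound(1)[OF v]])
      moreover have "(\<Sum>i<m. basis_proj e k (v i)) = basis_proj e k (x - r m)"
        by (simp add: linear_sum[OF lin] flip: sum_v)
      moreover have "norm (\<Sum>i. basis_proj e k (v (i + m))) \<le> 2 * (c * norm x * (1/2) ^ m)"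
        by (rule summable_geometric_bound(2)) (use v[of k "_ + m"] in \<open>simp add: power_add mult_ac\<close>)
      ultimately show ?thesis by simp
    qed
    \<comment> \<open>The tail beyond \<open>m\<close> is small uniformly in \<open>k\<close>, the
      remainder \<open>r m\<close> is small, and for fixed \<open>m\<close> the projections of
      \<open>x - r m\<close> converge. The constant \<open>2 * c + 1\<close> collects the tail and
      the remainder.\<close>
    have "T \<longlonglongrightarrow> x"
    proof (rule metric_LIMSEQ_I)
      fix \<epsilon> :: real assume \<epsilon>: "0 < \<epsilon>"
      have "(\<lambda>m. ((2 * c + 1) * norm x) * (1/2) ^ m) \<longlonglongrightarrow> ((2 * c + 1) * norm x) * 0"
        by (intro tendsto_mult_left LIMSEQ_power_zero) simp
      then have "\<forall>\<^sub>F m in sequentially. ((2 * c + 1) * norm x) * (1/2) ^ m < \<epsilon> / 2"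
        using \<epsilon> by (intro order_tendstoD(2)) auto
      then obtain m where m: "((2 * c + 1) * norm x) * (1/2) ^ m < \<epsilon> / 2"
        by (auto simp: eventually_sequentially)
      obtain k0 where k0: "\<And>k. k0 \<le> k \<Longrightarrow> norm (basis_proj e k (x - r m) - (x - r m)) < \<epsilon> / 2"
        using LIMSEQ_D[OF basis_proj_tendsto[OF e], of "\<epsilon> / 2" "x - r m"] \<epsilon> by auto
      have "dist (T k) x < \<epsilon>" if "k0 \<le> k" for k
      proof -
        have "T k - x = (T k - basis_proj e k (x - r m)) + (basis_proj e k (x - r m) - (x - r m)) - r m"
          by simp
        then have "norm (T k - x) \<le> norm (T k - basis_proj e k (x - r m))
            + norm (basis_proj e k (x - r m) - (x - r m)) + norm (r m)"
          by (metis (no_types) norm_triangle_ineq norm_triangle_ineq4 add_right_mono order_trans)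
        also have "\<dots> < 2 * (c * norm x * (1/2) ^ m) + \<epsilon> / 2 + norm x * (1/2) ^ m"
          using tail[of k m] k0[OF that] r[of m] by linarith
        also have "\<dots> < \<epsilon>" using m by (simp add: algebra_simps)
        finally show ?thesis by (simp add: dist_norm)
      qed
      then show "\<exists>no. \<forall>n\<ge>no. dist (T n) x < \<epsilon>" by blast
    qed
    then have "(\<lambda>n. a n *\<^sub>R e n) sums x" by (simp add: sums_def_le T_eq[abs_def])
    then have "basis_proj e k x = T k"
      by (simp add: basis_proj_def T_eq basis_coeff_unique[OF e])
    then show ?thesis using T[of k] by simp
  qed
  then show thesis using that[of "2 * c"] c(1) by simp
qed

section \<open>A countable boundary for a polyhedral norm\<close>

text \<open>Among the indices maximal at \<open>t = 0\<close>, one of largest slope wins. It beats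
  each competitor on some interval to the right of 0, and finitely many such intervals have a common
  part.\<close>

lemma finite_affine_max:
  fixes a b :: "'i \<Rightarrow> real"
  assumes "finite I" "I \<noteq> {}"
  obtains i \<epsilon> where "i \<in> I" "0 < \<epsilon>"
    "\<And>j t. j \<in> I \<Longrightarrow> 0 \<le> t \<Longrightarrow> t \<le> \<epsilon> \<Longrightarrow> a j + t * b j \<le> a i + t * b i"
proof -
  define J where "J = {i \<in> I. \<forall>j\<in>I. a j \<le> a i}"
  have "Max (a ` I) \<in> a ` I" using assms by (intro Max_in) auto
  then obtain i0 where "i0 \<in> I" "a i0 = Max (a ` I)" by auto
  then have "i0 \<in> J" using assms(1) by (auto simp: J_def)
  then have J: "finite J" "J \<noteq> {}" using assms(1) by (auto simp: J_def)
  have "Max (b ` J) \<in> b ` J" using J by (intro Max_in) auto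
  then obtain i where i: "i \<in> J" "b i = Max (b ` J)" by auto
  have b_le: "b j \<le> b i" if "j \<in> J" for j using that J(1) i(2) by simp
  have "\<forall>\<^sub>F t in at_right 0. \<forall>j\<in>I. a j + t * b j \<le> a i + t * b i"
  proof (rule eventually_ball_finite[OF assms(1)], rule ballI)
    fix j assume j: "j \<in> I"
    show "\<forall>\<^sub>F t in at_right 0. a j + t * b j \<le> a i + t * b i"
    proof (cases "j \<in> J")
      case True
      then have "a j = a i" using i(1) by (auto simp: J_def intro: antisym)
      then show ?thesis using b_le[OF True]
        by (auto simp: eventually_at_right_less intro!: eventually_mono[OF eventually_at_right_less[of 0]] mult_left_mono)
    next
      case False
      then have "a j < a i" using j i(1) unfolding J_def by (force simp: not_le)
      moreover have "((\<lambda>t. (a i + t * b i) - (a j + t * b j)) \<longlongrightarrow> (a i + 0 * b i) - (a j + 0 * b j)) (at_right 0)"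
        by (intro tendsto_intros)
      ultimately have "\<forall>\<^sub>F t in at_right 0. 0 < (a i + t * b i) - (a j + t * b j)"
        by (intro order_tendstoD(1)) auto
      then show ?thesis by eventually_elim simp
    qed
  qed
  then obtain d where d: "0 < d" "\<And>t j. 0 < t \<Longrightarrow> t < d \<Longrightarrow> j \<in> I \<Longrightarrow> a j + t * b j \<le> a i + t * b i"
    unfolding eventually_at_right[OF zero_less_one] by blast
  show thesis
  proof (rule that[of i "d / 2"])
    show "i \<in> I" using i(1) by (simp add: J_def)
    show "0 < d / 2" using d by simp
    show "a j + t * b j \<le> a i + t * b i" if "j \<in> I" "0 \<le> t" "t \<le> d / 2" for j t
    proof (cases "t = 0")
      case True
      then show ?thesis using that(1) i(1) by (simp add: J_def)
    next
      case False
      then show ?thesis using that d by simp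
    qed
  qed
qed

text \<open>In the coordinates \<open>real \<times> real\<close> the unit ball of the plane is a
  finite intersection of half-planes. After normalising their right-hand sides to 1, the normals are
  the functionals whose maximum is the norm.\<close>

lemma polyhedral_norm_plane:
  fixes L :: "real \<times> real \<Rightarrow> 'a::real_vector"
  assumes N: "is_norm N" "polyhedral_norm N" and L: "linear L" "inj L"
  obtains G :: "(real \<times> real) set" where "finite G"
    "\<And>g z. g \<in> G \<Longrightarrow> g \<bullet> z \<le> N (L z)" "\<And>z. z \<noteq> 0 \<Longrightarrow> \<exists>g\<in>G. g \<bullet> z = N (L z)"
proof -
  define x where "x = L (1, 0)"
  define y where "y = L (0, 1)"
  have L_eq: "L (a, b) = a *\<^sub>R x + b *\<^sub>R y" for a b
    using linear_add[OF L(1), of "a *\<^sub>R (1, 0)" "b *\<^sub>R (0, 1)"]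
      linear_scale[OF L(1), of a "(1, 0)"] linear_scale[OF L(1), of b "(0, 1)"]
    by (simp add: x_def y_def)
  have span: "span {x, y} = range L"
    by (auto simp: span_insert image_def L_eq algebra_simps)
  obtain g where g: "linear g" "g \<circ> L = id"
    using linear_injective_left_inverse[OF L] by blast
  have gL: "g (L z) = z" for z using g(2) by (metis comp_apply id_apply)
  define Q where "Q = {z. N (L z) \<le> 1}"
  have "polytope {u \<in> span {x, y}. N u \<le> 1}"
    using N(2) by (auto simp: polyhedral_norm_def)
  from polytope_linear_image[OF g(1) this] have "polytope (g ` {u \<in> span {x, y}. N u \<le> 1})" .
  moreover have "g ` {u \<in> span {x, y}. N u \<le> 1} = Q"
    by (force simp: span Q_def gL image_iff)
  ultimately have "polyhedron Q" by (metis polytope_imp_polyhedron)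
  then obtain F where F: "finite F" "Q = \<Inter>F" "\<And>h. h \<in> F \<Longrightarrow> \<exists>a b. a \<noteq> 0 \<and> h = {z. a \<bullet> z \<le> b}"
    unfolding polyhedron_def by blast
  obtain a b where ab: "\<And>h. h \<in> F \<Longrightarrow> a h \<noteq> 0" "\<And>h z. h \<in> F \<Longrightarrow> z \<in> h \<longleftrightarrow> a h \<bullet> z \<le> b h"
    using F(3) by (metis (mono_tags, lifting) mem_Collect_eq)
  have scale: "N (L (s *\<^sub>R z)) = \<bar>s\<bar> * N (L z)" for s z
    by (simp add: linear_scale[OF L(1)] is_norm_scale[OF N(1)])
  have pos: "0 < N (L z)" if "z \<noteq> 0" for z
    by (rule is_norm_pos[OF N(1)]) (use that L(2) linear_injective_0[OF L(1)] in blast)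
  have inQ: "z \<in> Q \<longleftrightarrow> (\<forall>h\<in>F. a h \<bullet> z \<le> b h)" for z
    unfolding F(2) Inter_iff by (rule ball_cong[OF refl ab(2)])
  \<comment> \<open>A positive multiple of the normal \<open>a h\<close> lies in \<open>Q\<close>,
    and the constraint is positive there.\<close>
  have b: "0 < b h" if h: "h \<in> F" for h
  proof -
    define s where "s = 1 / N (L (a h))"
    have Na: "0 < N (L (a h))" by (rule pos[OF ab(1)[OF h]])
    then have s: "0 < s" by (simp add: s_def)
    have "N (L (s *\<^sub>R a h)) = 1" using Na by (simp add: scale s_def)
    then have "s *\<^sub>R a h \<in> Q" by (simp add: Q_def)
    then have "s * (a h \<bullet> a h) \<le> b h" using inQ h by auto
    moreover have "0 < s * (a h \<bullet> a h)" using s ab(1)[OF h] by simp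
    ultimately show ?thesis by linarith
  qed
  define G where "G = (\<lambda>h. (1 / b h) *\<^sub>R a h) ` F"
  have inG: "N (L z) \<le> 1 \<longleftrightarrow> (\<forall>g\<in>G. g \<bullet> z \<le> 1)" for z
    using inQ[of z] b by (auto simp: G_def Q_def field_simps)
  have inG': "N (L z) \<le> r \<longleftrightarrow> (\<forall>g\<in>G. g \<bullet> z \<le> r)" if "0 < r" for z r
    using inG[of "(1 / r) *\<^sub>R z"] that unfolding scale by (simp add: field_simps)
  have finG: "finite G" using F(1) by (simp add: G_def)
  show thesis
  proof (rule that[OF finG])
    show le: "g \<bullet> z \<le> N (L z)" if "g \<in> G" for g z
      using inG'[of "N (L z)" z] pos[of z] that by (cases "z = 0") (auto simp: linear_0[OF L(1)] is_norm_zero[OF N(1)])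
    show "\<exists>g\<in>G. g \<bullet> z = N (L z)" if "z \<noteq> 0" for z
    proof (rule ccontr)
      assume "\<not> ?thesis"
      then have lt: "g \<bullet> z < N (L z)" if "g \<in> G" for g using le[OF that, of z] that by force
      \<comment> \<open>If no functional reached \<open>N (L z)\<close>, this \<open>r\<close> would
        be a smaller bound for all of them. The entry \<open>N (L z) / 2\<close> keeps it positive,
        as the rescaled description of the ball requires.\<close>
      define r where "r = Max (insert (N (L z) / 2) ((\<lambda>g. g \<bullet> z) ` G))"
      have "r < N (L z)" using finG lt pos[OF that] by (auto simp: r_def)
      moreover have "N (L z) / 2 \<le> r" unfolding r_def using finG by (intro Max_ge) auto
      moreover from this have "0 < r" using pos[OF that] by linarith
      moreover have "\<forall>g\<in>G. g \<bullet> z \<le> r" using finG by (auto simp: r_def)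
      ultimately show False using inG'[of r z] by simp
    qed
  qed
qed

text \<open>On the plane through \<open>x\<close> and \<open>y\<close> the norm is a maximum of
  finitely many linear functionals, hence along \<open>x + t y\<close> a maximum of finitely many
  affine functions. Collinear vectors are treated directly, as they give no injective
  parametrisation of a plane.\<close>

lemma polyhedral_norm_one_sided_linear:
  assumes N: "is_norm N" "polyhedral_norm N"
  shows "\<exists>p. \<exists>\<epsilon>>0. \<forall>t. 0 \<le> t \<and> t \<le> \<epsilon> \<longrightarrow> N (x + t *\<^sub>R y) = N x + t * p"
proof -
  consider "x = 0" | c where "y = c *\<^sub>R x" | "x \<noteq> 0" "\<And>c. y \<noteq> c *\<^sub>R x" by blast
  then show ?thesis
  proof cases
    case 1
    then show ?thesis
      by (intro exI[of _ "N y"] exI[of _ 1]) (simp add: is_norm_scale[OF N(1)] is_norm_zero[OF N(1)])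
  next
    case 2
    \<comment> \<open>The bound on \<open>t\<close> keeps the factor \<open>1 + t * c\<close>
      nonnegative.\<close>
    have "N (x + t *\<^sub>R y) = N x + t * (c * N x)" if "0 \<le> t" "t \<le> 1 / (\<bar>c\<bar> + 1)" for t
    proof -
      have "t * \<bar>c\<bar> \<le> 1" using that by (simp add: field_simps)
      then have "\<bar>t * c\<bar> \<le> 1" using that(1) by (simp add: abs_mult)
      then have "\<bar>1 + t * c\<bar> = 1 + t * c" by linarith
      moreover have "x + t *\<^sub>R y = (1 + t * c) *\<^sub>R x" by (simp add: 2 algebra_simps)
      ultimately show ?thesis by (simp only: is_norm_scale[OF N(1)]) (simp add: algebra_simps)
    qed
    then show ?thesis by (intro exI[of _ "c * N x"] exI[of _ "1 / (\<bar>c\<bar> + 1)"]) auto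
  next
    case 3
    define L where "L z = fst z *\<^sub>R x + snd z *\<^sub>R y" for z :: "real \<times> real"
    have L: "linear L" by (rule linearI) (simp_all add: L_def algebra_simps)
    have "inj L"
      unfolding linear_injective_0[OF L]
    proof (intro allI impI)
      fix z assume z: "L z = 0"
      have "snd z = 0"
      proof (rule ccontr)
        assume nz: "snd z \<noteq> 0"
        have "snd z *\<^sub>R y = - (fst z *\<^sub>R x)" using z by (simp add: L_def eq_neg_iff_add_eq_0 add.commute)
        then have "(1 / snd z) *\<^sub>R (snd z *\<^sub>R y) = (- (fst z / snd z)) *\<^sub>R x" by simp
        then have "y = (- (fst z / snd z)) *\<^sub>R x" using nz by simp
        then show False using 3(2) by blast
      qed
      then show "z = 0" using z 3(1) by (simp add: L_def prod_eq_iff)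
    qed
    then obtain G where G: "finite G" "\<And>g z. g \<in> G \<Longrightarrow> g \<bullet> z \<le> N (L z)"
      "\<And>z. z \<noteq> 0 \<Longrightarrow> \<exists>g\<in>G. g \<bullet> z = N (L z)"
      using polyhedral_norm_plane[OF N L] by metis
    have "G \<noteq> {}" using G(3)[of "(1, 0)"] by (auto simp: zero_prod_def)
    then obtain g \<epsilon> where g: "g \<in> G" "0 < \<epsilon>"
      "\<And>h t. h \<in> G \<Longrightarrow> 0 \<le> t \<Longrightarrow> t \<le> \<epsilon> \<Longrightarrow> fst h + t * snd h \<le> fst g + t * snd g"
      using finite_affine_max[OF G(1), of fst snd] by metis
    have eq: "N (x + t *\<^sub>R y) = fst g + t * snd g" if t: "0 \<le> t" "t \<le> \<epsilon>" for t
    proof -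
      have "(1 :: real, t) \<noteq> 0" by (simp add: zero_prod_def)
      then obtain h where h: "h \<in> G" "h \<bullet> (1, t) = N (L (1, t))" using G(3) by blast
      have "N (L (1, t)) = fst h + t * snd h" using h(2) by (cases h) (simp add: mult.commute)
      also have "\<dots> \<le> fst g + t * snd g" using g(3) h(1) t by blast
      finally have "N (L (1, t)) \<le> fst g + t * snd g" .
      moreover have "fst g + t * snd g \<le> N (L (1, t))"
        using G(2)[OF g(1), of "(1, t)"] by (cases g) (simp add: mult.commute)
      ultimately show ?thesis by (simp add: L_def)
    qed
    have "N x = fst g" using eq[of 0] g(2) by simp
    then show ?thesis using eq g(2) by (intro exI[of _ "snd g"] exI[of _ \<epsilon>]) auto
  qed
qed

section \<open>One-sided derivatives of a polyhedral norm\<close>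

text \<open>The one-sided directional derivative, taken as the slope on an actual segment and not as
  a limit: the later arguments need exact equality on that segment.\<close>

definition dir_deriv :: "('a::real_vector \<Rightarrow> real) \<Rightarrow> 'a \<Rightarrow> 'a \<Rightarrow> real" where
  "dir_deriv N x y = (SOME p. \<exists>\<epsilon>>0. \<forall>t. 0 \<le> t \<and> t \<le> \<epsilon> \<longrightarrow> N (x + t *\<^sub>R y) = N x + t * p)"

lemma dir_derivE:
  assumes "is_norm N" "polyhedral_norm N"
  obtains \<epsilon> where "0 < \<epsilon>" "\<And>t. 0 \<le> t \<Longrightarrow> t \<le> \<epsilon> \<Longrightarrow> N (x + t *\<^sub>R y) = N x + t * dir_deriv N x y"
  using someI_ex[OF polyhedral_norm_one_sided_linear[OF assms, of x y], folded dir_deriv_def] by blast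

lemma dir_deriv_unique:
  assumes N: "is_norm N" "polyhedral_norm N"
    and d: "0 < \<delta>" "\<And>t. 0 \<le> t \<Longrightarrow> t \<le> \<delta> \<Longrightarrow> N (x + t *\<^sub>R y) = N x + t * p"
  shows "dir_deriv N x y = p"
proof -
  obtain \<epsilon> where \<epsilon>: "0 < \<epsilon>" "\<And>t. 0 \<le> t \<Longrightarrow> t \<le> \<epsilon> \<Longrightarrow> N (x + t *\<^sub>R y) = N x + t * dir_deriv N x y"
    using dir_derivE[OF N] by blast
  define t where "t = min \<epsilon> \<delta>"
  have t: "0 < t" "t \<le> \<epsilon>" "t \<le> \<delta>" using \<epsilon> d by (auto simp: t_def)
  then have "t * dir_deriv N x y = t * p" using \<epsilon>(2)[of t] d(2)[of t] by simp
  then show ?thesis using t(1) by simp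
qed

text \<open>Convexity: a point of the initial linear segment is a convex combination of
  \<open>x\<close> and \<open>x + t y\<close>.\<close>

lemma dir_deriv_le_quotient:
  assumes N: "is_norm N" "polyhedral_norm N" and t: "0 \<le> t"
  shows "N x + t * dir_deriv N x y \<le> N (x + t *\<^sub>R y)"
proof (cases "t = 0")
  case False
  then have t: "0 < t" using t by simp
  obtain \<epsilon> where \<epsilon>: "0 < \<epsilon>" "\<And>s. 0 \<le> s \<Longrightarrow> s \<le> \<epsilon> \<Longrightarrow> N (x + s *\<^sub>R y) = N x + s * dir_deriv N x y"
    using dir_derivE[OF N] by blast
  define r where "r = min 1 (\<epsilon> / t)"
  have r: "0 < r" "r \<le> 1" "r * t \<le> \<epsilon>" using \<epsilon> t by (auto simp: r_def field_simps min_def)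
  have "x + (r * t) *\<^sub>R y = (1 - r) *\<^sub>R x + r *\<^sub>R (x + t *\<^sub>R y)" by (simp add: algebra_simps)
  then have "N (x + (r * t) *\<^sub>R y) \<le> N ((1 - r) *\<^sub>R x) + N (r *\<^sub>R (x + t *\<^sub>R y))"
    using is_norm_triangle[OF N(1)] by simp
  then have "N x + (r * t) * dir_deriv N x y \<le> (1 - r) * N x + r * N (x + t *\<^sub>R y)"
    using r t \<epsilon>(2)[of "r * t"] by (simp add: is_norm_scale[OF N(1)])
  then have "r * (N x + t * dir_deriv N x y) \<le> r * N (x + t *\<^sub>R y)" by (simp add: algebra_simps)
  then show ?thesis using r(1) by simp
qed simp

lemma dir_deriv_le:
  assumes N: "is_norm N" "polyhedral_norm N"
  shows "dir_deriv N x y \<le> N y"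
  using dir_deriv_le_quotient[OF N, of 1 x y] is_norm_triangle[OF N(1), of x y] by simp

lemma dir_deriv_self:
  assumes N: "is_norm N" "polyhedral_norm N"
  shows "dir_deriv N x x = N x"
proof (rule dir_deriv_unique[OF N zero_less_one])
  show "N (x + t *\<^sub>R x) = N x + t * N x" if "0 \<le> t" for t
    using that is_norm_scale[OF N(1), of "1 + t" x] by (simp add: algebra_simps)
qed

text \<open>For subadditivity, \<open>x + t (y + z)\<close> is the midpoint of
  \<open>x + 2 t y\<close> and \<open>x + 2 t z\<close>, and for small \<open>t\<close> both lie
  where \<open>N\<close> is affine.\<close>

lemma sublinear_dir_deriv:
  assumes N: "is_norm N" "polyhedral_norm N"
  shows "sublinear (dir_deriv N x)"
  unfolding sublinear_def
proof (intro conjI allI impI)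
  fix y z
  obtain \<epsilon> where \<epsilon>: "0 < \<epsilon>" "\<And>t. 0 \<le> t \<Longrightarrow> t \<le> \<epsilon> \<Longrightarrow> N (x + t *\<^sub>R y) = N x + t * dir_deriv N x y"
    using dir_derivE[OF N] by blast
  obtain \<delta> where \<delta>: "0 < \<delta>" "\<And>t. 0 \<le> t \<Longrightarrow> t \<le> \<delta> \<Longrightarrow> N (x + t *\<^sub>R z) = N x + t * dir_deriv N x z"
    using dir_derivE[OF N] by blast
  define t where "t = min \<epsilon> \<delta> / 2"
  have t: "0 < t" "2 * t \<le> \<epsilon>" "2 * t \<le> \<delta>" using \<epsilon> \<delta> by (auto simp: t_def)
  have "2 * (N x + t * dir_deriv N x (y + z)) \<le> 2 * N (x + t *\<^sub>R (y + z))"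
    using dir_deriv_le_quotient[OF N, of t x "y + z"] t(1) by simp
  also have "\<dots> = N ((x + (2 * t) *\<^sub>R y) + (x + (2 * t) *\<^sub>R z))"
    using is_norm_scale[OF N(1), of 2 "x + t *\<^sub>R (y + z)"]
    by (simp add: algebra_simps scaleR_2 flip: scaleR_left_distrib)
  also have "\<dots> \<le> N (x + (2 * t) *\<^sub>R y) + N (x + (2 * t) *\<^sub>R z)" by (rule is_norm_triangle[OF N(1)])
  also have "\<dots> = 2 * N x + 2 * t * (dir_deriv N x y + dir_deriv N x z)"
    using t \<epsilon>(2)[of "2 * t"] \<delta>(2)[of "2 * t"] by (simp add: algebra_simps)
  finally have "t * dir_deriv N x (y + z) \<le> t * (dir_deriv N x y + dir_deriv N x z)" by (simp add: algebra_simps)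
  then show "dir_deriv N x (y + z) \<le> dir_deriv N x y + dir_deriv N x z" using t(1) by simp
next
  fix c :: real and y assume c: "0 \<le> c"
  obtain \<epsilon> where \<epsilon>: "0 < \<epsilon>" "\<And>t. 0 \<le> t \<Longrightarrow> t \<le> \<epsilon> \<Longrightarrow> N (x + t *\<^sub>R y) = N x + t * dir_deriv N x y"
    using dir_derivE[OF N] by blast
  show "dir_deriv N x (c *\<^sub>R y) = c * dir_deriv N x y"
  proof (rule dir_deriv_unique[OF N])
    \<comment> \<open>The denominator \<open>c + 1\<close> also covers \<open>c = 0\<close>.\<close>
    show "0 < \<epsilon> / (c + 1)" using \<epsilon> c by simp
    fix t assume t: "0 \<le> t" "t \<le> \<epsilon> / (c + 1)"
    have "t * c \<le> t * (c + 1)" using t by (simp add: mult_left_mono)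
    also have "\<dots> \<le> \<epsilon>" using t c by (simp add: field_simps)
    finally show "N (x + t *\<^sub>R (c *\<^sub>R y)) = N x + t * (c * dir_deriv N x y)"
      using \<epsilon>(2)[of "t * c"] t c by (simp add: mult.assoc)
  qed
qed

text \<open>A small positive multiple of any \<open>y\<close> can be added to \<open>x\<close>
  without leaving \<open>U\<close>.\<close>

lemma linear_eq_on_open:
  fixes f g :: "'a::real_normed_vector \<Rightarrow> real"
  assumes "linear f" "linear g" "open U" "x \<in> U" "\<And>y. y \<in> U \<Longrightarrow> f y = g y"
  shows "f = g"
proof
  fix y
  have "\<forall>\<^sub>F t in at_right 0. x + t *\<^sub>R y \<in> U"
  proof (rule topological_tendstoD)
    have "((\<lambda>t. x + t *\<^sub>R y) \<longlongrightarrow> x + 0 *\<^sub>R y) (at_right 0)" by (intro tendsto_intros)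
    then show "((\<lambda>t. x + t *\<^sub>R y) \<longlongrightarrow> x) (at_right 0)" by simp
  qed (use assms in auto)
  then obtain t :: real where t: "0 < t" "x + t *\<^sub>R y \<in> U"
    unfolding eventually_at_right[OF zero_less_one] by (metis dense)
  have "f (x + t *\<^sub>R y) = g (x + t *\<^sub>R y)" "f x = g x" using assms t by blast+
  then show "f y = g y"
    using t(1) by (simp add: linear_add linear_scale assms(1,2))
qed

text \<open>Finite rational combinations are coded by lists of rationals, which makes their
  countability immediate. For sums the shorter list is padded with zeros. Their closure is closed
  under addition and contains all multiples of the \<open>e i\<close>, hence the span.\<close>

lemma countable_dense_of_dense_span:
  fixes e :: "nat \<Rightarrow> 'a::real_normed_vector"
  assumes dense: "closure (span (range e)) = UNIV"
  obtains Q :: "'a set" where "countable Q" "closure Q = UNIV"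
proof -
  define q where "q l = (\<Sum>i<length l. of_rat (l ! i) *\<^sub>R e i)" for l :: "rat list"
  define T where "T = closure (range q)"
  have add: "q l + q m \<in> range q" for l m
  proof -
    define k where "k = max (length l) (length m)"
    define c where "c l i = (if i < length l then l ! i else 0)" for l :: "rat list" and i
    have c: "q l = (\<Sum>i<k. of_rat (c l i) *\<^sub>R e i)" if "length l \<le> k" for l
      unfolding q_def c_def using that
      by (intro sum.mono_neutral_cong_left) auto
    have "q (map (\<lambda>i. c l i + c m i) [0..<k]) = q l + q m"
      unfolding c[of l, unfolded k_def, OF max.cobounded1, folded k_def]
        c[of m, unfolded k_def, OF max.cobounded2, folded k_def]
      by (simp add: q_def scaleR_left_distrib sum.distrib of_rat_add)
    then show ?thesis by (metis rangeI)
  qed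
  have single: "of_rat r *\<^sub>R e i \<in> range q" for r i
  proof -
    have "q (replicate i 0 @ [r]) = of_rat r *\<^sub>R e i"
      by (simp add: q_def nth_append)
    then show ?thesis by (metis rangeI)
  qed
  have addT: "x + y \<in> T" if x: "x \<in> T" and y: "y \<in> T" for x y
    unfolding T_def closure_approachable
  proof (intro allI impI)
    fix d :: real assume "0 < d"
    then obtain l m where lm: "dist (q l) x < d / 2" "dist (q m) y < d / 2"
      using x y half_gt_zero unfolding T_def closure_approachable by (metis (no_types, lifting) rangeE)
    have "dist (q l + q m) (x + y) \<le> dist (q l) x + dist (q m) y" by (rule dist_triangle_add)
    then show "\<exists>z\<in>range q. dist z (x + y) < d" using lm add[of l m] by (intro bexI) auto
  qed
  have scaleT: "c *\<^sub>R e i \<in> T" for c i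
    unfolding T_def closure_approachable
  proof (intro allI impI)
    fix d :: real assume d: "0 < d"
    have "c < c + d / (norm (e i) + 1)" using d by (simp add: add_nonneg_pos)
    then obtain r where r: "c < of_rat r" "of_rat r < c + d / (norm (e i) + 1)"
      using of_rat_dense by blast
    have "dist (of_rat r *\<^sub>R e i) (c *\<^sub>R e i) = (of_rat r - c) * norm (e i)"
      using r by (simp add: dist_norm flip: scaleR_left_diff_distrib)
    also have "\<dots> \<le> (of_rat r - c) * (norm (e i) + 1)" using r by (intro mult_left_mono) auto
    also have "\<dots> < d"
    proof -
      have "of_rat r - c < d / (norm (e i) + 1)" using r by simp
      then show ?thesis by (subst (asm) pos_less_divide_eq) (simp_all add: add_nonneg_pos)
    qed
    finally show "\<exists>z\<in>range q. dist z (c *\<^sub>R e i) < d" using single by blast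
  qed
  have "span (range e) \<subseteq> T"
  proof
    fix x assume "x \<in> span (range e)"
    then show "x \<in> T"
    proof (induction rule: span_induct_alt)
      case base
      show ?case using scaleT[of 0 0] by simp
    next
      case (step c x y)
      then show ?case using addT scaleT by auto
    qed
  qed
  then have "closure (range q) = UNIV"
    using closure_minimal[of "span (range e)" T] dense by (auto simp: T_def)
  then show thesis by (intro that[of "range q"]) auto
qed

section \<open>Smooth points of a polyhedral norm\<close>

context
  fixes N :: "'a::banach \<Rightarrow> real" and e :: "nat \<Rightarrow> 'a"
  assumes N: "is_norm N" "equivalent_norms norm N" "polyhedral_norm N"
    and dense_span: "closure (span (range e)) = UNIV"
begin

text \<open>As \<open>t\<close> decreases to 0, the symmetric second difference divided by
  \<open>t\<close> decreases to the sum of the derivatives along \<open>e n\<close> and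
  \<open>- e n\<close>. Smallness at a single \<open>t\<close> therefore bounds this sum, and it is
  an open condition.\<close>

definition almost_smooth :: "nat \<Rightarrow> nat \<Rightarrow> 'a set" where
  "almost_smooth n j = {x. \<exists>t>0. N (x + t *\<^sub>R e n) + N (x - t *\<^sub>R e n) - 2 * N x < t / (real j + 1)}"

text \<open>The points of Gateaux differentiability. Testing only the directions \<open>e n\<close>
  leaves a countable intersection, as Baire's theorem demands.\<close>

definition smooth_points :: "'a set" where
  "smooth_points = (\<Inter>n. \<Inter>j. almost_smooth n j)"

lemma open_almost_smooth: "open (almost_smooth n j)"
proof -
  have c: "continuous_on UNIV N" by (rule equivalent_norm_continuous_on[OF N(1,2)])
  have "open {x. N (x + t *\<^sub>R e n) + N (x - t *\<^sub>R e n) - 2 * N x < t / (real j + 1)}" for t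
    by (intro open_Collect_less continuous_intros continuous_on_compose2[OF c]) auto
  moreover have "almost_smooth n j =
      (\<Union>t\<in>{0<..}. {x. N (x + t *\<^sub>R e n) + N (x - t *\<^sub>R e n) - 2 * N x < t / (real j + 1)})"
    by (auto simp: almost_smooth_def)
  ultimately show ?thesis by auto
qed

text \<open>A short move from \<open>x\<close> along \<open>e n\<close> leads into the interior of a
  segment on which \<open>N\<close> is affine, and there the second difference vanishes for small
  \<open>t\<close>.\<close>

lemma dense_almost_smooth: "closure (almost_smooth n j) = UNIV"
proof -
  have "x \<in> closure (almost_smooth n j)" for x
  proof -
    obtain \<epsilon> where \<epsilon>: "0 < \<epsilon>"
      "\<And>t. 0 \<le> t \<Longrightarrow> t \<le> \<epsilon> \<Longrightarrow> N (x + t *\<^sub>R e n) = N x + t * dir_deriv N x (e n)"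
      using dir_derivE[OF N(1,3)] by blast
    have "x + s *\<^sub>R e n \<in> almost_smooth n j" if s: "0 < s" "s < \<epsilon>" for s
    proof -
      define t where "t = min s (\<epsilon> - s)"
      have t: "0 < t" "t \<le> s" "s + t \<le> \<epsilon>" using s by (auto simp: t_def)
      have "N (x + s *\<^sub>R e n + t *\<^sub>R e n) = N x + (s + t) * dir_deriv N x (e n)"
        using \<epsilon>(2)[of "s + t"] s t by (simp add: algebra_simps)
      moreover have "N (x + s *\<^sub>R e n - t *\<^sub>R e n) = N x + (s - t) * dir_deriv N x (e n)"
        using \<epsilon>(2)[of "s - t"] s t by (simp add: algebra_simps)
      moreover have "N (x + s *\<^sub>R e n) = N x + s * dir_deriv N x (e n)"
        using \<epsilon>(2)[of s] s by simp
      ultimately have "N (x + s *\<^sub>R e n + t *\<^sub>R e n) + N (x + s *\<^sub>R e n - t *\<^sub>R e n) - 2 * N (x + s *\<^sub>R e n) = 0"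
        by (simp add: algebra_simps)
      then show ?thesis using t(1) by (auto simp: almost_smooth_def intro!: exI[of _ t])
    qed
    then have "x + s *\<^sub>R e n \<in> closure (almost_smooth n j)" if "0 < s" "s < \<epsilon>" for s
      using that closure_subset by blast
    then have "\<forall>\<^sub>F s in at_right 0. x + s *\<^sub>R e n \<in> closure (almost_smooth n j)"
      using \<epsilon>(1) by (auto simp: eventually_at_right[OF zero_less_one])
    moreover have "((\<lambda>s. x + s *\<^sub>R e n) \<longlongrightarrow> x + 0 *\<^sub>R e n) (at_right 0)"
      by (intro tendsto_intros)
    ultimately have "x + 0 *\<^sub>R e n \<in> closure (almost_smooth n j)"
      by (intro Lim_in_closed_set[OF closed_closure _ trivial_limit_at_right_real])
    then show ?thesis by simp
  qed
  then show ?thesis by auto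
qed

text \<open>The sum of the derivatives along \<open>e n\<close> and \<open>- e n\<close> is
  nonnegative by sublinearity and below every \<open>1 / (j + 1)\<close>, so the derivative is odd
  along each \<open>e n\<close>. The vectors on which it is odd form a subspace, closed by Lipschitz
  continuity, hence the whole space.\<close>

lemma smooth_linear:
  assumes "x \<in> smooth_points"
  shows "linear (dir_deriv N x)"
proof -
  note sub = sublinear_dir_deriv[OF N(1,3), of x]
  have odd: "dir_deriv N x (- e n) = - dir_deriv N x (e n)" for n
  proof -
    define q where "q = dir_deriv N x (e n) + dir_deriv N x (- e n)"
    have "q < 1 / (real j + 1)" for j
    proof -
      obtain t where t: "0 < t" "N (x + t *\<^sub>R e n) + N (x - t *\<^sub>R e n) - 2 * N x < t / (real j + 1)"
        using assms by (auto simp: smooth_points_def almost_smooth_def)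
      have "t * q \<le> N (x + t *\<^sub>R e n) + N (x - t *\<^sub>R e n) - 2 * N x"
        using dir_deriv_le_quotient[OF N(1,3), of t x "e n"] dir_deriv_le_quotient[OF N(1,3), of t x "- e n"] t(1)
        by (simp add: q_def algebra_simps)
      then have "t * q < t * (1 / (real j + 1))" using t(2) by simp
      then show ?thesis using t(1) by (simp only: mult_less_cancel_left_pos)
    qed
    note q_less = this
    have "q \<le> 0"
    proof (rule ccontr)
      assume "\<not> q \<le> 0"
      then obtain j where "inverse (real (Suc j)) < q" using reals_Archimedean[of q] by auto
      then show False using q_less[of j] by (simp add: inverse_eq_divide add.commute)
    qed
    then show ?thesis using sublinear_minus[OF sub, of "e n"] by (simp add: q_def)
  qed
  define S where "S = {v. dir_deriv N x (- v) = - dir_deriv N x v}"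
  have "span (range e) \<subseteq> S"
    unfolding S_def by (intro span_minimal subspace_sublinear_odd sub) (auto simp: odd)
  moreover have "closed S"
  proof -
    obtain c C where C: "\<And>x. N x \<le> C * norm x" using equivalent_norms_normE[OF N(2)] by metis
    have cont: "continuous_on UNIV (dir_deriv N x)"
    proof (rule lipschitz_continuous_on)
      show "dir_deriv N x y - dir_deriv N x z \<le> C * norm (y - z)" for y z
        using sublinear_add[OF sub, of "y - z" z] dir_deriv_le[OF N(1,3), of x "y - z"] C[of "y - z"] by simp
    qed
    have "continuous_on UNIV (\<lambda>v. dir_deriv N x (- v))"
      by (rule continuous_on_compose2[OF cont continuous_on_minus[OF continuous_on_id]]) auto
    then show ?thesis
      unfolding S_def by (intro closed_Collect_eq continuous_on_minus cont)
  qed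
  ultimately have "S = UNIV" using closure_minimal[of "span (range e)" S] dense_span by auto
  then have "dir_deriv N x (- v) = - dir_deriv N x v" for v by (auto simp: S_def)
  then show ?thesis
    by (intro linearI) (simp_all add: sublinear_odd_add[OF sub] sublinear_odd_scale[OF sub])
qed

text \<open>By Baire the closed cone on which \<open>N\<close> agrees with the derivative at a smooth point has
  interior, since the translates \<open>{y. x + y / (n + 1) \<in> cone}\<close> cover the space.\<close>

lemma smooth_cone_interior:
  assumes "x \<in> smooth_points"
  shows "interior {z. N z = dir_deriv N x z} \<noteq> {}"
proof -
  define f where "f = dir_deriv N x"
  define K where "K = {z. N z = f z}"
  have lin: "linear f" unfolding f_def by (rule smooth_linear[OF assms])
  obtain c C where C: "\<And>x. N x \<le> C * norm x" using equivalent_norms_normE[OF N(2)] by metis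
  have f_le: "f z \<le> C * norm z" for z
    unfolding f_def using dir_deriv_le[OF N(1,3), of x z] C[of z] by simp
  have "\<bar>f z\<bar> \<le> C * norm z" for z
    using f_le[of z] f_le[of "-z"] by (simp add: linear_neg[OF lin] abs_le_iff)
  then have "closed K"
    unfolding K_def
    by (intro closed_Collect_eq equivalent_norm_continuous_on[OF N(1,2)] linear_bounded_continuous_on[OF lin])
  define S where "S n = (\<lambda>y. x + (1 / real (Suc n)) *\<^sub>R y) -` K" for n
  have "closed (S n)" for n
    unfolding S_def by (intro closed_vimage \<open>closed K\<close> continuous_intros)
  moreover have "(\<Union>n. S n) = UNIV"
  proof -
    have "\<exists>n. y \<in> S n" for y
    proof -
      obtain \<epsilon> where \<epsilon>: "0 < \<epsilon>" "\<And>t. 0 \<le> t \<Longrightarrow> t \<le> \<epsilon> \<Longrightarrow> N (x + t *\<^sub>R y) = N x + t * f y"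
        using dir_derivE[OF N(1,3)] unfolding f_def by blast
      obtain n where "1 / real (Suc n) < \<epsilon>" using nat_approx_posE[OF \<epsilon>(1)] by blast
      \<comment> \<open>Along the segment \<open>N\<close> and \<open>f\<close> are affine with the
        same slope, and they agree at \<open>x\<close> since the derivative at \<open>x\<close> in
        direction \<open>x\<close> is \<open>N x\<close>.\<close>
      then have "N (x + (1 / real (Suc n)) *\<^sub>R y) = f (x + (1 / real (Suc n)) *\<^sub>R y)"
        using \<epsilon>(2)[of "1 / real (Suc n)"] dir_deriv_self[OF N(1,3), of x, folded f_def]
        by (simp add: linear_add[OF lin] linear_scale[OF lin])
      then show ?thesis by (auto simp: S_def K_def)
    qed
    then show ?thesis by blast
  qed
  ultimately obtain n where n: "interior (S n) \<noteq> {}" using Baire_closed_union by blast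
  define r where "r = 1 / real (Suc n)"
  have "open ((\<lambda>y. x + r *\<^sub>R y) ` interior (S n))"
  proof -
    have "(\<lambda>y. x + r *\<^sub>R y) ` interior (S n) = (+) x ` (\<lambda>y. r *\<^sub>R y) ` interior (S n)"
      by (simp add: image_image)
    then show ?thesis
      using open_translation[OF open_scaling[of r "interior (S n)"], of x] by (simp add: r_def)
  qed
  moreover have "(\<lambda>y. x + r *\<^sub>R y) ` interior (S n) \<subseteq> K"
    using interior_subset[of "S n"] by (auto simp: S_def r_def)
  ultimately have "(\<lambda>y. x + r *\<^sub>R y) ` interior (S n) \<subseteq> interior K" by (rule interior_maximal[rotated])
  then show ?thesis using n by (auto simp: K_def f_def)
qed

text \<open>Each derivative owns a nonempty open set on which it equals \<open>N\<close>. Two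
  derivatives whose open sets meet coincide, so a point of a countable dense set in its open set
  identifies each of them.\<close>

lemma countable_smooth_functionals: "countable (dir_deriv N ` smooth_points)"
proof -
  obtain Q :: "'a set" where Q: "countable Q" "closure Q = UNIV"
    using countable_dense_of_dense_span[OF dense_span] by blast
  define U where "U f = interior {z. N z = f z}" for f
  define \<Phi> where "\<Phi> = dir_deriv N ` smooth_points"
  define g where "g q = (SOME f. f \<in> \<Phi> \<and> q \<in> U f)" for q
  have "\<Phi> \<subseteq> g ` Q"
  proof
    fix f assume f: "f \<in> \<Phi>"
    then have "U f \<noteq> {}" using smooth_cone_interior by (auto simp: U_def \<Phi>_def)
    then have "U f \<inter> Q \<noteq> {}"
      using open_Int_closure_eq_empty[of "U f" Q] Q(2) by (simp add: U_def)
    then obtain q where q: "q \<in> U f" "q \<in> Q" by blast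
    have g: "g q \<in> \<Phi> \<and> q \<in> U (g q)"
      unfolding g_def by (rule someI[of _ f]) (use f q in blast)
    have "f = g q"
    proof (rule linear_eq_on_open)
      show "linear f" "linear (g q)" using f g smooth_linear by (auto simp: \<Phi>_def)
      show "open (U f \<inter> U (g q))" by (simp add: U_def open_Int)
      show "q \<in> U f \<inter> U (g q)" using q g by blast
      show "f y = g q y" if "y \<in> U f \<inter> U (g q)" for y
      proof -
        have "y \<in> {z. N z = f z}" "y \<in> {z. N z = g q z}"
          using that interior_subset unfolding U_def by blast+
        then show ?thesis by simp
      qed
    qed
    then show "f \<in> g ` Q" using q by blast
  qed
  then show ?thesis
    using countable_image[OF Q(1), of g] unfolding \<Phi>_def by (rule countable_subset)
qed

text \<open>By Baire there is \<open>y\<close> with all \<open>x + y / (k + 1)\<close> smooth; for large \<open>k\<close> this point lies on the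
  segment on which \<open>N\<close> is linear, so the derivative there attains \<open>N\<close> at \<open>x\<close> as well.\<close>

lemma smooth_functional_attains: "\<exists>z\<in>smooth_points. dir_deriv N z x = N x"
proof -
  define r where "r k = 1 / real (Suc k)" for k
  define W where "W k n j = (\<lambda>y. x + r k *\<^sub>R y) -` almost_smooth n j" for k n j
  have r: "0 < r k" for k by (simp add: r_def)
  have W_open: "open (W k n j)" for k n j
    unfolding W_def by (intro open_vimage open_almost_smooth continuous_intros)
  have W_dense: "closure (W k n j) = UNIV" for k n j
  proof -
    have "y \<in> closure (W k n j)" for y
      unfolding closure_approachable
    proof (intro allI impI)
      fix d :: real assume d: "0 < d"
      have "x + r k *\<^sub>R y \<in> closure (almost_smooth n j)" by (simp add: dense_almost_smooth)
      then obtain a where a: "a \<in> almost_smooth n j" "dist a (x + r k *\<^sub>R y) < r k * d"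
        using d r unfolding closure_approachable by (meson mult_pos_pos)
      define u where "u = (1 / r k) *\<^sub>R (a - x)"
      have eq: "x + r k *\<^sub>R u = a" using r[of k] by (simp add: u_def)
      have "r k * dist u y = norm (r k *\<^sub>R (u - y))" using r[of k] by (simp add: dist_norm)
      also have "r k *\<^sub>R (u - y) = a - (x + r k *\<^sub>R y)" by (simp add: scaleR_diff_right flip: eq)
      finally have "r k * dist u y < r k * d" using a(2) by (simp add: dist_norm)
      then have "dist u y < d" using r[of k] by simp
      moreover have "u \<in> W k n j" using a(1) eq by (simp add: W_def)
      ultimately show "\<exists>z\<in>W k n j. dist z y < d" by blast
    qed
    then show ?thesis by auto
  qed
  \<comment> \<open>The three indices are coded into one, because Baire's theorem is applied to a
    sequence.\<close>
  define W' where "W' m = (case prod_decode m of (k, l) \<Rightarrow> case prod_decode l of (n, j) \<Rightarrow> W k n j)" for m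
  have "closure (\<Inter>m. W' m) = UNIV"
    by (rule Baire_open_dense) (auto simp: W'_def W_open W_dense split: prod.split)
  then have "(\<Inter>m. W' m) \<noteq> {}" by (metis closure_empty UNIV_not_empty)
  then obtain y where y: "\<And>m. y \<in> W' m" by blast
  have smooth: "x + r k *\<^sub>R y \<in> smooth_points" for k
  proof -
    have "y \<in> W k n j" for n j using y[of "prod_encode (k, prod_encode (n, j))"] by (simp add: W'_def)
    then show ?thesis by (simp add: smooth_points_def W_def)
  qed
  obtain \<epsilon> where \<epsilon>: "0 < \<epsilon>" "\<And>t. 0 \<le> t \<Longrightarrow> t \<le> \<epsilon> \<Longrightarrow> N (x + t *\<^sub>R y) = N x + t * dir_deriv N x y"
    using dir_derivE[OF N(1,3)] by blast
  obtain k where k: "r k < \<epsilon>" using nat_approx_posE[OF \<epsilon>(1)] unfolding r_def by blast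
  define z where "z = x + r k *\<^sub>R y"
  have lin: "linear (dir_deriv N z)" using smooth_linear smooth by (simp add: z_def)
  have Nz: "N z = N x + r k * dir_deriv N x y"
    using \<epsilon>(2)[of "r k"] k r[of k] by (simp add: z_def)
  have "dir_deriv N z y = dir_deriv N x y"
  proof (rule dir_deriv_unique[OF N(1,3)])
    show "0 < \<epsilon> - r k" using k by simp
    show "N (z + t *\<^sub>R y) = N z + t * dir_deriv N x y" if "0 \<le> t" "t \<le> \<epsilon> - r k" for t
      using \<epsilon>(2)[of "r k + t"] that r[of k] unfolding Nz by (simp add: z_def algebra_simps)
  qed
  \<comment> \<open>By linearity, subtracting \<open>r k\<close> times the common slope from the
    value \<open>N z\<close> at \<open>z\<close> leaves the value at \<open>x\<close>, which is
    therefore \<open>N x\<close>.\<close>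
  moreover have "dir_deriv N z z = N z" by (rule dir_deriv_self[OF N(1,3)])
  moreover have "dir_deriv N z z = dir_deriv N z x + r k * dir_deriv N z y"
    by (subst (2) z_def) (simp add: linear_add[OF lin] linear_scale[OF lin])
  ultimately have "dir_deriv N z x = N x" using Nz by simp
  then show ?thesis using smooth z_def by blast
qed

lemma polyhedral_norm_countable_boundary:
  obtains f :: "nat \<Rightarrow> 'a \<Rightarrow> real" where "\<And>n. linear (f n)" "\<And>n x. f n x \<le> N x"
    "\<And>x. \<exists>n. f n x = N x"
proof -
  define \<Phi> where "\<Phi> = dir_deriv N ` smooth_points"
  have "countable \<Phi>" "\<Phi> \<noteq> {}"
    using countable_smooth_functionals smooth_functional_attains by (auto simp: \<Phi>_def)
  then have range: "range (from_nat_into \<Phi>) = \<Phi>" by (rule range_from_nat_into[rotated])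
  show thesis
  proof (rule that[of "from_nat_into \<Phi>"])
    have "from_nat_into \<Phi> n \<in> \<Phi>" for n using range by blast
    moreover have "linear f" "f x \<le> N x" if "f \<in> \<Phi>" for f x
      using that smooth_linear dir_deriv_le[OF N(1,3)] by (auto simp: \<Phi>_def)
    ultimately show "linear (from_nat_into \<Phi> n)" "from_nat_into \<Phi> n x \<le> N x" for n x
      by blast+
    show "\<exists>n. from_nat_into \<Phi> n x = N x" for x
    proof -
      obtain z where "z \<in> smooth_points" "dir_deriv N z x = N x" using smooth_functional_attains by blast
      then have "dir_deriv N z \<in> range (from_nat_into \<Phi>)" unfolding range by (simp add: \<Phi>_def)
      then show ?thesis using \<open>dir_deriv N z x = N x\<close> by (metis rangeE)
    qed
  qed
qed

end

section \<open>The two renormings\<close>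

lemma equivalent_norm_banach:
  fixes N :: "'a::banach \<Rightarrow> real"
  assumes N: "is_norm N" "equivalent_norms norm N"
  shows "is_banach_norm N"
proof -
  obtain c C where C: "c > 0" "C > 0" "\<And>x. c * norm x \<le> N x" "\<And>x. N x \<le> C * norm x"
    using equivalent_norms_normE[OF N(2)] by metis
  interpret M: Metric_space UNIV "\<lambda>x y. N (x - y)" by (rule is_norm_Metric_space[OF N(1)])
  have "M.mcomplete"
    unfolding M.mcomplete_def
  proof (intro allI impI)
    fix s assume s: "M.MCauchy s"
    have "Cauchy s"
    proof (rule CauchyI)
      fix d :: real assume "0 < d"
      then obtain n where n: "\<And>i j. n \<le> i \<Longrightarrow> n \<le> j \<Longrightarrow> N (s i - s j) < c * d"
        using s C(1) unfolding M.MCauchy_def by (meson mult_pos_pos)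
      have "norm (s i - s j) < d" if "n \<le> i" "n \<le> j" for i j
      proof -
        have "c * norm (s i - s j) < c * d" using n[OF that] C(3)[of "s i - s j"] by linarith
        then show ?thesis using C(1) by simp
      qed
      then show "\<exists>M. \<forall>m\<ge>M. \<forall>n\<ge>M. norm (s m - s n) < d" by blast
    qed
    then obtain l where l: "s \<longlonglongrightarrow> l" using Cauchy_convergent convergent_def by blast
    have "limitin M.mtopology s l sequentially"
      unfolding M.limitin_metric
    proof (intro conjI allI impI UNIV_I)
      fix d :: real assume d: "0 < d"
      have "\<forall>\<^sub>F n in sequentially. norm (s n - l) < d / C"
        using tendstoD[OF l, of "d / C"] d C(2) by (simp add: dist_norm)
      then show "\<forall>\<^sub>F n in sequentially. s n \<in> UNIV \<and> N (s n - l) < d"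
      proof eventually_elim
        case (elim n)
        then have "C * norm (s n - l) < d" using C(2) by (simp add: field_simps)
        then show ?case using C(4)[of "s n - l"] by simp
      qed
    qed
    then show "\<exists>x. limitin M.mtopology s x sequentially" by blast
  qed
  then show ?thesis using N(1) by (simp add: is_banach_norm_def)
qed

lemma polyhedral_norm_pullback:
  fixes T :: "'a::real_vector \<Rightarrow> 'b::real_vector"
  assumes T: "linear T" "bij T" and N: "polyhedral_norm N"
  shows "polyhedral_norm (\<lambda>x. N (T x))"
  unfolding polyhedral_norm_def
proof (intro allI impI)
  fix B :: "'a set" assume B: "finite B"
  obtain S where S: "linear S" "S \<circ> T = id"
    using linear_injective_left_inverse[OF T(1) bij_is_inj[OF T(2)]] by blast
  have ST: "S (T x) = x" for x using S(2) by (metis comp_apply id_apply)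
  have "{x \<in> span B. N (T x) \<le> 1} = S ` {y \<in> span (T ` B). N y \<le> 1}"
  proof -
    have "S ` {y \<in> span (T ` B). N y \<le> 1} = S ` T ` {x \<in> span B. N (T x) \<le> 1}"
      unfolding linear_span_image[OF T(1)] by auto
    then show ?thesis by (simp add: image_image ST)
  qed
  moreover have "polytope {y \<in> span (T ` B). N y \<le> 1}"
    using N B by (simp add: polyhedral_norm_def)
  ultimately show "polytope {x \<in> span B. N (T x) \<le> 1}"
    using polytope_linear_image[OF S(1)] by metis
qed

text \<open>Pulling the norm back along the isomorphism turns isomorphic spaces into equivalent
  norms on one space.\<close>

lemma isomorphically_polyhedralE:
  fixes M :: "'a::real_vector \<Rightarrow> real"
  assumes "isomorphically_polyhedral M"
  obtains N :: "'a \<Rightarrow> real" where "is_norm N" "equivalent_norms M N" "polyhedral_norm N"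
proof -
  obtain N :: "'a \<Rightarrow> real" and T where N: "is_norm N" "polyhedral_norm N" and T: "linear T" "bij T"
    and eq: "\<exists>c>0. \<exists>C>0. \<forall>x. c * M x \<le> N (T x) \<and> N (T x) \<le> C * M x"
    using assms unfolding isomorphically_polyhedral_def is_banach_norm_def isomorphic_normed_def by blast
  show thesis
  proof (rule that[of "\<lambda>x. N (T x)"])
    have "T x = 0 \<longleftrightarrow> x = 0" for x
      using linear_injective_0[OF T(1)] bij_is_inj[OF T(2)] linear_0[OF T(1)] by blast
    then show "is_norm (\<lambda>x. N (T x))"
      using N(1) by (simp add: is_norm_def linear_add[OF T(1)] linear_scale[OF T(1)])
    show "equivalent_norms M (\<lambda>x. N (T x))" using eq by (simp add: equivalent_norms_def)
    show "polyhedral_norm (\<lambda>x. N (T x))" by (rule polyhedral_norm_pullback[OF T N(2)])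
  qed
qed

lemma isomorphically_polyhedral_of_equivalent:
  fixes N :: "'a::banach \<Rightarrow> real"
  assumes "is_norm N" "equivalent_norms norm N" "polyhedral_norm N"
  shows "isomorphically_polyhedral (norm :: 'a \<Rightarrow> real)"
proof (rule isomorphically_polyhedralI)
  show "is_banach_norm N" by (rule equivalent_norm_banach) fact+
  show "isomorphic_normed (norm :: 'a \<Rightarrow> real) N"
    unfolding isomorphic_normed_def
    by (rule exI[of _ "\<lambda>x. x"]) (use assms(2) in \<open>simp add: equivalent_norms_def linear_ident bij_id[unfolded id_def]\<close>)
qed fact

lemma basis_proj_in_span: "basis_proj e k x \<in> span (e ` {..k})"
  unfolding basis_proj_def by (intro span_sum span_scale span_base) auto

text \<open>By monotonicity and convergence \<open>N (basis_proj e k x)\<close> increases to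
  \<open>N x\<close>; once the value \<open>N x\<close> is taken, it is kept for all larger
  \<open>k\<close>.\<close>

lemma polyhedral_of_monotone_norm:
  fixes e :: "nat \<Rightarrow> 'a::banach" and N :: "'a \<Rightarrow> real"
  assumes e: "schauder_basis e" and N: "is_norm N" "equivalent_norms norm N"
    and mono: "monotone_basis_wrt N e"
    and attained: "\<And>x. \<exists>m. N x = N (basis_proj e m x)"
  shows "isomorphically_polyhedral (norm :: 'a \<Rightarrow> real)"
proof -
  have "incseq (\<lambda>k. N (basis_proj e k x))" for x
    using mono unfolding monotone_basis_wrt_def basis_proj_def by (intro incseq_SucI) blast
  then have inc: "N (basis_proj e j x) \<le> N (basis_proj e k x)" if "j \<le> k" for j k x
    using that by (auto dest: incseqD)
  have le: "N (basis_proj e k x) \<le> N x" for k x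
  proof (rule LIMSEQ_le_const)
    have "isCont N x"
      using equivalent_norm_continuous_on[OF N, of UNIV] by (simp add: continuous_on_eq_continuous_at)
    then show "(\<lambda>j. N (basis_proj e j x)) \<longlonglongrightarrow> N x"
      by (rule isCont_tendsto_compose[OF _ basis_proj_tendsto[OF e]])
    show "\<exists>n. \<forall>j\<ge>n. N (basis_proj e k x) \<le> N (basis_proj e j x)" using inc by blast
  qed
  have "\<forall>\<^sub>F k in sequentially. N (basis_proj e k x) = N x" for x
  proof -
    obtain m where "N x = N (basis_proj e m x)" using attained by blast
    then have "N (basis_proj e k x) = N x" if "m \<le> k" for k
      using inc[OF that, of x] le[of k x] by simp
    then show ?thesis unfolding eventually_sequentially by blast
  qed
  moreover have "\<exists>B. finite B \<and> (\<forall>x. basis_proj e k x \<in> span B)" for k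
    using basis_proj_in_span by (intro exI[of _ "e ` {..k}"]) auto
  ultimately obtain M :: "'a \<Rightarrow> real" where "is_norm M" "equivalent_norms norm M" "polyhedral_norm M"
    using polyhedral_renorming[OF N, of "basis_proj e"] linear_basis_proj[OF e] le by blast
  then show ?thesis by (rule isomorphically_polyhedral_of_equivalent)
qed

lemma basis_dense_span:
  assumes "schauder_basis e"
  shows "closure (span (range e)) = UNIV"
proof -
  have "basis_proj e k x \<in> span (range e)" for k x
    using basis_proj_in_span span_mono[of "e ` {..k}" "range e"] by blast
  then have "x \<in> closure (span (range e))" for x
    using basis_proj_tendsto[OF assms, of x] unfolding closure_sequential
    by (intro exI[of _ "\<lambda>k. basis_proj e k x"]) simp
  then show ?thesis by blast
qed

text \<open>Boundedness of the projections makes \<open>Blinfun\<close> faithful on them, so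
  convergence in the dual norm becomes an estimate for the functions themselves.\<close>

lemma shrinking_uniform:
  fixes e :: "nat \<Rightarrow> 'a::banach" and f :: "'a \<Rightarrow> real"
  assumes e: "schauder_basis e" "shrinking e" and f: "bounded_linear f" and "0 < \<delta>"
  shows "\<exists>k. \<forall>x. \<bar>f (basis_proj e k x) - f x\<bar> \<le> \<delta> * norm x"
proof -
  obtain K where "\<And>k x. norm (basis_proj e k x) \<le> K * norm x" using basis_proj_bounded[OF e(1)] by metis
  then have bl: "bounded_linear (basis_proj e k)" for k
    using linear_basis_proj[OF e(1), of k]
    by (intro bounded_linear_intro[of _ K]) (auto simp: linear_add linear_scale mult.commute)
  obtain k where k: "norm ((Blinfun f o\<^sub>L Blinfun (basis_proj e k)) - Blinfun f) < \<delta>"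
    using LIMSEQ_D[OF e(2)[unfolded shrinking_def, rule_format, of "Blinfun f"] \<open>0 < \<delta>\<close>] by blast
  have "\<bar>f (basis_proj e k x) - f x\<bar> \<le> \<delta> * norm x" for x
  proof -
    have "f (basis_proj e k x) - f x = blinfun_apply ((Blinfun f o\<^sub>L Blinfun (basis_proj e k)) - Blinfun f) x"
      by (simp add: minus_blinfun.rep_eq bounded_linear_Blinfun_apply f bl)
    then have "\<bar>f (basis_proj e k x) - f x\<bar>
        \<le> norm ((Blinfun f o\<^sub>L Blinfun (basis_proj e k)) - Blinfun f) * norm x"
      using norm_blinfun by (metis real_norm_def)
    also have "\<dots> \<le> \<delta> * norm x" using k by (intro mult_right_mono) auto
    finally show ?thesis .
  qed
  then show ?thesis by blast
qed

lemma monotone_norm_of_polyhedral: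
  fixes e :: "nat \<Rightarrow> 'a::banach" and N :: "'a \<Rightarrow> real"
  assumes e: "schauder_basis e" "shrinking e"
    and N: "is_norm N" "equivalent_norms norm N" "polyhedral_norm N"
  obtains M :: "'a \<Rightarrow> real" where "is_norm M" "equivalent_norms norm M" "monotone_basis_wrt M e"
    "\<And>x. \<exists>m. M x = M (basis_proj e m x)"
proof -
  define P where "P = basis_proj e"
  have P: "linear (P k)" "P j (P k x) = P (min j k) x" for j k x
    by (simp_all add: P_def linear_basis_proj basis_proj_proj e(1))
  obtain K where K: "0 < K" "\<And>k x. norm (P k x) \<le> K * norm x"
    using basis_proj_bounded[OF e(1)] unfolding P_def by metis
  obtain c C where C: "c > 0" "C > 0" "\<And>x. c * norm x \<le> N x" "\<And>x. N x \<le> C * norm x"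
    using equivalent_norms_normE[OF N(2)] by metis
  obtain f :: "nat \<Rightarrow> 'a \<Rightarrow> real" where f: "\<And>n. linear (f n)" "\<And>n x. f n x \<le> N x"
    "\<And>x. \<exists>n. f n x = N x"
    using polyhedral_norm_countable_boundary[OF N basis_dense_span[OF e(1)]] by blast
  have absf: "\<bar>f n x\<bar> \<le> N x" for n x
    using f(2)[of n x] f(2)[of n "-x"] by (simp add: linear_neg[OF f(1)] is_norm_minus[OF N(1)] abs_le_iff)
  have blf: "bounded_linear (f n)" for n
    using order_trans[OF absf C(4)]
    by (intro bounded_linear_intro[of _ C]) (auto simp: linear_add[OF f(1)] linear_scale[OF f(1)] mult.commute)
  obtain w \<epsilon> :: "nat \<Rightarrow> real" where w: "\<And>m. 1 < w m" "\<And>m. w m \<le> 2"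
    and \<epsilon>: "\<And>m. 0 < \<epsilon> m" "\<And>m. \<epsilon> m < 1"
    and w\<epsilon>: "\<And>m. 1 < w m * (1 - \<epsilon> m)" and w_lim: "w \<longlonglongrightarrow> 1"
    using norming_weights by metis
  \<comment> \<open>The factor \<open>c\<close> turns the error, a multiple of
    \<open>norm x\<close>, into at most \<open>\<epsilon> n * N x\<close>.\<close>
  have "\<exists>k. \<forall>x. \<bar>f n (P k x) - f n x\<bar> \<le> (\<epsilon> n * c) * norm x" for n
    unfolding P_def by (rule shrinking_uniform[OF e blf]) (simp add: \<epsilon> C)
  then obtain \<kappa> where "\<And>n x. \<bar>f n (P (\<kappa> n) x) - f n x\<bar> \<le> (\<epsilon> n * c) * norm x" by metis
  moreover have "(\<epsilon> n * c) * norm x \<le> \<epsilon> n * N x" for n x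
    using \<epsilon>(1)[of n] C(3)[of x] by (simp add: mult.assoc)
  ultimately have \<kappa>: "\<bar>f n (P (\<kappa> n) x) - f n x\<bar> \<le> \<epsilon> n * N x" for n x
    using order_trans by blast
  \<comment> \<open>With \<open>(n, k)\<close> every \<open>(n, j)\<close> for
    \<open>j \<le> k\<close> belongs to \<open>I\<close>, which makes the projections contractive
    for \<open>M\<close>. The finiteness of each row is needed for attainment.\<close>
  define I where "I = (SIGMA n:UNIV. {..\<kappa> n})"
  define h where "h = (\<lambda>(n, k) x. w n * f n (P k x))"
  define M where "M = sup_fun I h"
  have I: "I \<noteq> {}" by (auto simp: I_def)
  have lin: "linear (h i)" for i
    by (cases i) (auto simp: h_def linear_add[OF f(1)] linear_scale[OF f(1)] linear_add[OF P(1)]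
        linear_scale[OF P(1)] algebra_simps intro!: linearI)
  have abs_h: "\<bar>h (n, k) x\<bar> = w n * \<bar>f n (P k x)\<bar>" for n k x
    using w(1)[of n] by (simp add: h_def abs_mult)
  have h_le: "\<bar>h (n, k) x\<bar> \<le> w n * N (P k x)" for n k x
    unfolding abs_h using absf w(1)[of n] by (intro mult_left_mono) auto
  have upper: "\<bar>h i x\<bar> \<le> (2 * (C * K)) * norm x" for i x
  proof (cases i)
    case (Pair n k)
    have "N (P k x) \<le> C * (K * norm x)"
      using C(4)[of "P k x"] mult_left_mono[OF K(2)[of k x], of C] C(2) by linarith
    then have "w n * N (P k x) \<le> 2 * (C * (K * norm x))"
      using w[of n] is_norm_nonneg[OF N(1), of "P k x"] by (intro mult_mono) auto
    then show ?thesis using h_le[of n k x] Pair by simp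
  qed
  have CK: "0 < 2 * (C * K)" using C K by simp
  have near: "N z < w n * \<bar>f n (P (\<kappa> n) z)\<bar>" if z: "z \<noteq> 0" "f n z = N z" for n z
  proof -
    have "N z < (w n * (1 - \<epsilon> n)) * N z" using w\<epsilon>[of n] is_norm_pos[OF N(1) z(1)] by simp
    also have "\<dots> = w n * ((1 - \<epsilon> n) * N z)" by simp
    also have "\<dots> \<le> w n * \<bar>f n (P (\<kappa> n) z)\<bar>"
      using \<kappa>[of n z] w(1)[of n] z(2) by (intro mult_left_mono) (auto simp: algebra_simps)
    finally show ?thesis .
  qed
  have above: "\<exists>i\<in>I. N x < \<bar>h i x\<bar>" if x: "x \<noteq> 0" for x
  proof -
    obtain n where "f n x = N x" using f(3) by blast
    then have "N x < \<bar>h (n, \<kappa> n) x\<bar>" unfolding abs_h by (rule near[OF x])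
    then show ?thesis by (intro bexI[of _ "(n, \<kappa> n)"]) (auto simp: I_def)
  qed
  \<comment> \<open>If \<open>k > \<kappa> n\<close>, the index \<open>(n, k)\<close> is not available, but \<open>P\<^sub>k x\<close> and \<open>x\<close> have the same
    projection of order \<open>\<kappa> n\<close>.\<close>
  have above_proj: "\<exists>i\<in>I. N (P k x) < \<bar>h i x\<bar>" if x: "P k x \<noteq> 0" for k x
  proof -
    obtain n where n: "f n (P k x) = N (P k x)" using f(3) by blast
    have Nx: "0 < N (P k x)" by (rule is_norm_pos[OF N(1) x])
    show ?thesis
    proof (cases "k \<le> \<kappa> n")
      case True
      have "N (P k x) < \<bar>h (n, k) x\<bar>" unfolding abs_h n using Nx w(1)[of n] by simp
      then show ?thesis using True by (intro bexI[of _ "(n, k)"]) (auto simp: I_def)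
    next
      case False
      have "N (P k x) < w n * \<bar>f n (P (\<kappa> n) (P k x))\<bar>" by (rule near[OF x n])
      also have "P (\<kappa> n) (P k x) = P (\<kappa> n) x" using False by (simp add: P(2) min_def)
      finally have "N (P k x) < \<bar>h (n, \<kappa> n) x\<bar>" unfolding abs_h .
      then show ?thesis by (intro bexI[of _ "(n, \<kappa> n)"]) (auto simp: I_def)
    qed
  qed
  have h_le_M: "\<bar>h i x\<bar> \<le> M x" if "i \<in> I" for i x
    unfolding M_def sup_fun_def
    by (rule cSUP_upper[OF that]) (use upper in \<open>auto intro!: bdd_aboveI2\<close>)
  have lower: "c * norm x \<le> M x" for x
  proof (cases "x = 0")
    case True
    obtain i where "i \<in> I" using I by blast
    from h_le_M[OF this, of x] True show ?thesis by simp
  next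
    case False
    obtain i where "i \<in> I" "N x < \<bar>h i x\<bar>" using above[OF False] by blast
    then show ?thesis using h_le_M[of i x] C(3)[of x] by linarith
  qed
  have M: "is_norm M" "equivalent_norms norm M"
    unfolding M_def
    by (rule sup_fun_norm[of I h "2 * (C * K)" c];
        use I lin upper CK lower[unfolded M_def] C(1) in blast)+
  have M_least: "M x \<le> a" if "\<And>i. i \<in> I \<Longrightarrow> \<bar>h i x\<bar> \<le> a" for x a
    unfolding M_def sup_fun_def by (rule cSUP_least[OF I that])
  have M_proj: "M (P j x) \<le> M x" for j x
  proof (rule M_least)
    fix i assume "i \<in> I"
    then obtain n k where i: "i = (n, k)" "k \<le> \<kappa> n" by (auto simp: I_def)
    have "h i (P j x) = h (n, min k j) x" by (simp add: i h_def P(2))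
    moreover have "(n, min k j) \<in> I" using i by (auto simp: I_def)
    ultimately show "\<bar>h i (P j x)\<bar> \<le> M x" using h_le_M by metis
  qed
  have attained: "\<exists>i\<in>I. \<bar>h i x\<bar> = M x" if x: "x \<noteq> 0" for x
  proof (rule ccontr)
    assume "\<not> ?thesis"
    then have lt: "\<bar>h i x\<bar> < M x" if "i \<in> I" for i using h_le_M[OF that, of x] that by force
    have Nx: "0 < N x" by (rule is_norm_pos[OF N(1) x])
    have NM: "N x < M x" using above[OF x] lt order.strict_trans by blast
    \<comment> \<open>\<open>N x < M x\<close> alone is not enough: \<open>N\<close> need not be
      monotone, and the tail of the supremum is controlled by the numbers
      \<open>N (P k x)\<close>.\<close>
    have NPM: "N (P k x) < M x" for k
    proof (cases "P k x = 0")
      case True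
      then show ?thesis using Nx NM by (simp add: is_norm_zero[OF N(1)])
    next
      case False
      then show ?thesis using above_proj lt order.strict_trans by blast
    qed
    define s where "s = (N x + M x) / 2"
    have s: "N x < s" "s < M x" using NM by (auto simp: s_def)
    have "isCont N x"
      using equivalent_norm_continuous_on[OF N(1,2), of UNIV] by (simp add: continuous_on_eq_continuous_at)
    then have "(\<lambda>k. N (P k x)) \<longlonglongrightarrow> N x"
      unfolding P_def by (rule isCont_tendsto_compose[OF _ basis_proj_tendsto[OF e(1)]])
    from order_tendstoD(2)[OF this s(1)] obtain k0 where k0: "\<And>k. k0 \<le> k \<Longrightarrow> N (P k x) < s"
      by (auto simp: eventually_sequentially)
    \<comment> \<open>A bound for all \<open>N (P k x)\<close> that is still strictly below
      \<open>M x\<close>: for large \<open>k\<close> by convergence to \<open>N x < s\<close>, for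
      the finitely many others because each is below \<open>M x\<close>.\<close>
    define R where "R = Max (insert s ((\<lambda>k. N (P k x)) ` {..<k0}))"
    have R: "R < M x" "s \<le> R" "N (P k x) \<le> R" for k
    proof -
      show "R < M x" using s NPM by (simp add: R_def)
      show sR: "s \<le> R" unfolding R_def by (intro Max_ge) auto
      show "N (P k x) \<le> R"
      proof (cases "k < k0")
        case True
        then show ?thesis unfolding R_def by (intro Max_ge) auto
      next
        case False
        then show ?thesis using k0[of k] sR by simp
      qed
    qed
    \<comment> \<open>As the weights tend to 1, the rows from \<open>n0\<close> on stay below
      \<open>b\<close>. The other rows contain finitely many functionals, each strictly below
      \<open>M x\<close>, so \<open>a\<close> would be an upper bound smaller than the
      supremum.\<close>
    obtain b where b: "R < b" "b < M x" using dense[OF R(1)] by blast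
    have "(\<lambda>n. w n * R) \<longlonglongrightarrow> 1 * R" by (intro tendsto_mult_right w_lim)
    then have "\<forall>\<^sub>F n in sequentially. w n * R < b" using b(1) by (intro order_tendstoD(2)) auto
    then obtain n0 where n0: "\<And>n. n0 \<le> n \<Longrightarrow> w n * R < b" by (auto simp: eventually_sequentially)
    define J where "J = (SIGMA n:{..<n0}. {..\<kappa> n})"
    have J: "finite J" "J \<subseteq> I" by (auto simp: J_def I_def)
    define a where "a = Max (insert b ((\<lambda>i. \<bar>h i x\<bar>) ` J))"
    have "a < M x" using J lt b by (auto simp: a_def)
    moreover have "M x \<le> a"
    proof (rule M_least)
      fix i assume "i \<in> I"
      show "\<bar>h i x\<bar> \<le> a"
      proof (cases "i \<in> J")
        case True
        then show ?thesis unfolding a_def using J(1) by (intro Max_ge) auto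
      next
        case False
        obtain n k where i: "i = (n, k)" "n0 \<le> n" using False \<open>i \<in> I\<close> by (cases i) (auto simp: J_def I_def)
        have "\<bar>h i x\<bar> \<le> w n * N (P k x)" using h_le i by simp
        also have "\<dots> \<le> w n * R" using R(3) w(1)[of n] by (intro mult_left_mono) auto
        also have "\<dots> \<le> b" using n0[OF i(2)] by simp
        also have "b \<le> a" unfolding a_def using J(1) by (intro Max_ge) auto
        finally show ?thesis .
      qed
    qed
    ultimately show False by simp
  qed
  show thesis
  proof (rule that[OF M])
    show "monotone_basis_wrt M e"
      unfolding monotone_basis_wrt_def
    proof (intro allI)
      fix a :: "nat \<Rightarrow> real" and k
      have "P k (\<Sum>n\<le>Suc k. a n *\<^sub>R e n) = (\<Sum>n\<le>k. a n *\<^sub>R e n)"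
        unfolding P_def basis_proj_finite_sum[OF e(1)] by simp
      then show "M (\<Sum>n\<le>k. a n *\<^sub>R e n) \<le> M (\<Sum>n\<le>Suc k. a n *\<^sub>R e n)"
        using M_proj by metis
    qed
    show "\<exists>m. M x = M (basis_proj e m x)" for x
    proof (cases "x = 0")
      case True
      then show ?thesis using linear_0[OF P(1)] by (simp add: P_def)
    next
      case False
      then obtain n k where i: "(n, k) \<in> I" "\<bar>h (n, k) x\<bar> = M x" using attained by (metis surj_pair)
      \<comment> \<open>The attaining functional sees only \<open>P k x\<close>, so its index
        \<open>k\<close> serves as \<open>m\<close>.\<close>
      have "h (n, k) (P k x) = h (n, k) x" by (simp add: h_def P(2))
      then have "M x \<le> M (P k x)" using h_le_M[OF i(1), of "P k x"] i(2) by simp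
      then show ?thesis using M_proj[of k x] by (intro exI[of _ k]) (simp add: P_def)
    qed
  qed
qed

theorem theorem3:
  fixes e :: "nat \<Rightarrow> 'a::banach"
  assumes "schauder_basis e"
    and "shrinking e"
  shows "isomorphically_polyhedral (norm :: 'a \<Rightarrow> real) \<longleftrightarrow>
    (\<exists>N :: 'a \<Rightarrow> real. is_norm N \<and> equivalent_norms norm N \<and> monotone_basis_wrt N e \<and>
      (\<forall>a :: nat \<Rightarrow> real. summable (\<lambda>n. a n *\<^sub>R e n) \<longrightarrow>
        (\<exists>m. N (\<Sum>n. a n *\<^sub>R e n) = N (\<Sum>n\<le>m. a n *\<^sub>R e n))))"
proof -
  have proj: "(\<Sum>n\<le>m. a n *\<^sub>R e n) = basis_proj e m (\<Sum>n. a n *\<^sub>R e n)"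
    if "summable (\<lambda>n. a n *\<^sub>R e n)" for a m
    by (simp add: basis_proj_def basis_coeff_unique[OF assms(1) summable_sums[OF that]])
  \<comment> \<open>The partial sums of a convergent series are the projections of its sum, so
    quantifying over coefficient sequences amounts to quantifying over points.\<close>
  have attained: "(\<forall>a :: nat \<Rightarrow> real. summable (\<lambda>n. a n *\<^sub>R e n) \<longrightarrow>
        (\<exists>m. N (\<Sum>n. a n *\<^sub>R e n) = N (\<Sum>n\<le>m. a n *\<^sub>R e n)))
      \<longleftrightarrow> (\<forall>x. \<exists>m. N x = N (basis_proj e m x))" (is "?L \<longleftrightarrow> ?R") for N :: "'a \<Rightarrow> real"
  proof
    assume L: ?L
    show ?R
    proof
      fix x
      note s = basis_coeff_sums[OF assms(1), of x]
      show "\<exists>m. N x = N (basis_proj e m x)"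
        using L[rule_format, OF sums_summable[OF s]] by (simp add: basis_proj_def flip: sums_unique[OF s])
    qed
  qed (simp add: proj)
  show ?thesis
    unfolding attained
  proof
    assume "isomorphically_polyhedral (norm :: 'a \<Rightarrow> real)"
    then obtain N :: "'a \<Rightarrow> real" where N: "is_norm N" "equivalent_norms norm N" "polyhedral_norm N"
      by (rule isomorphically_polyhedralE)
    obtain M :: "'a \<Rightarrow> real" where "is_norm M" "equivalent_norms norm M" "monotone_basis_wrt M e"
      "\<And>x. \<exists>m. M x = M (basis_proj e m x)"
      using monotone_norm_of_polyhedral[OF assms N] by blast
    then show "\<exists>N. is_norm N \<and> equivalent_norms norm N \<and> monotone_basis_wrt N e \<and>
        (\<forall>x. \<exists>m. N x = N (basis_proj e m x))" by blast
  next
    assume "\<exists>N. is_norm N \<and> equivalent_norms norm N \<and> monotone_basis_wrt N e \<and>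
        (\<forall>x. \<exists>m. N x = N (basis_proj e m x))"
    then show "isomorphically_polyhedral (norm :: 'a \<Rightarrow> real)"
      using polyhedral_of_monotone_norm[OF assms(1)] by blast
  qed
qed

end
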